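(* Let $\varepsilon>0$ and let $p(\cdot), q(\cdot)\in \mathcal{P}(\mathbb{R})$ be such that $\mathscr{F}:L^{p(\cdot)}(\mathbb{R}) \to L^{q(\cdot)}(\mathbb{R})$ is bounded. (i) If $G$ is the disjoint union of a sequence of intervals $\{I_j\}_{j\in \mathbb{N}}$, $$\{x\in\mathbb{R} : p(x) > 2 + \varepsilon\}\subseteq G\quad \text{and}\quad |G \setminus \{x\in\mathbb{R} : p(x) > 2 + \varepsilon\}| < +\infty,$$ then $|I_j|\rightarrow 0$ as $j \to +\infty$. (ii) If $U$ is the disjoint union of a sequence of intervals $\{J_j\}_{j\in \mathbb{N}}$, $$\{x\in\mathbb{R} : q(x) < 2 - \varepsilon\}\subseteq U \quad \text{and}\quad|U \setminus \{x\in\mathbb{R} : q(x) < 2 - \varepsilon\}| < +\infty,$$ then $|J_j|\rightarrow 0$ as $j \to +\infty$.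
   Context: $|\cdot|$ denotes Lebesgue measure of a set. $\mathcal{P}(\mathbb{R})$ is the set of Lebesgue measurable functions (exponents) $p(\cdot):\mathbb{R}\to[1,+\infty]$. With $\Omega_\infty:=\{x: p(x)=+\infty\}$, the modular is $\rho_{p(\cdot)}(f):=\int_{\mathbb{R}\setminus\Omega_\infty}|f(x)|^{p(x)}dx+\|f\|_{L^\infty(\Omega_\infty)}$. $L^{p(\cdot)}(\mathbb{R})$ is the Banach space of measurable (complex-valued) functions $f$ with $\rho_{p(\cdot)}(f/\lambda)<\infty$ for some $\lambda>0$, with the Luxemburg norm $\|f\|_{L^{p(\cdot)}(\mathbb{R})}=\inf\{\lambda>0:\rho_{p(\cdot)}(f/\lambda)\le1\}$. The Fourier transform is $\mathscr{F}f=\hat f$, where $\hat f(\xi)=\int_{\mathbb{R}}f(x)e^{-2\pi i x\xi}dx$ for Schwartz $f$, extended to tempered distributions by $\langle\hat g,f\rangle=\langle g,\hat f\rangle$ for Schwartz $f$; every element of $L^{p(\cdot)}(\mathbb{R})$ defines a tempered distribution. "$\mathscr{F}:L^{p(\cdot)}(\mathbb{R})\to L^{q(\cdot)}(\mathbb{R})$ is bounded" means that there is $C>0$ such that for every $f\in L^{p(\cdot)}(\mathbb{R})$ the distribution $\hat f$ is (represented by) a function in $L^{q(\cdot)}(\mathbb{R})$ and $\|\hat f\|_{L^{q(\cdot)}(\mathbb{R})}\le C\|f\|_{L^{p(\cdot)}(\mathbb{R})}$. *)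

theory Defs
  imports "HOL-Analysis.Analysis" "HOL-Probability.Essential_Supremum"
begin

definition exponents :: "(real \<Rightarrow> ereal) set" where
  "exponents = {p \<in> borel_measurable lebesgue. \<forall>x. 1 \<le> p x}"

text \<open>The second summand is the norm on L-infinity of the set where the exponent is infinite; it is
  \<^term>\<open>0\<close> when that set is null.\<close>

definition modular :: "(real \<Rightarrow> ereal) \<Rightarrow> (real \<Rightarrow> complex) \<Rightarrow> ennreal" where
  "modular p f =
     (\<integral>\<^sup>+x\<in>{x. p x \<noteq> \<infinity>}. ennreal (norm (f x) powr real_of_ereal (p x)) \<partial>lebesgue)
     + esssup (restrict_space lebesgue {x. p x = \<infinity>}) (\<lambda>x. ennreal (norm (f x)))"

text \<open>Elements of the variable Lebesgue space are functions, not classes modulo equality almost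
  everywhere; the modular and the norm depend only on the class.\<close>

definition Lvar :: "(real \<Rightarrow> ereal) \<Rightarrow> (real \<Rightarrow> complex) set" where
  "Lvar p = {f \<in> borel_measurable lebesgue. \<exists>l>0. modular p (\<lambda>x. f x /\<^sub>R l) < \<infinity>}"

text \<open>The norm is only meaningful on \<^term>\<open>Lvar p\<close>, where the infimum is over a nonempty set.\<close>

definition Lvar_norm :: "(real \<Rightarrow> ereal) \<Rightarrow> (real \<Rightarrow> complex) \<Rightarrow> real" where
  "Lvar_norm p f = Inf {l. l > 0 \<and> modular p (\<lambda>x. f x /\<^sub>R l) \<le> 1}"

definition nth_deriv :: "nat \<Rightarrow> (real \<Rightarrow> complex) \<Rightarrow> real \<Rightarrow> complex" where
  "nth_deriv n f = ((\<lambda>g x. vector_derivative g (at x)) ^^ n) f"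

definition schwartz :: "(real \<Rightarrow> complex) set" where
  "schwartz = {f. (\<forall>n x. nth_deriv n f differentiable at x) \<and>
                  (\<forall>m n. bounded (range (\<lambda>x. x ^ m *\<^sub>R nth_deriv n f x)))}"

definition fourier :: "(real \<Rightarrow> complex) \<Rightarrow> real \<Rightarrow> complex" where
  "fourier f \<xi> = (LINT x|lebesgue. f x * exp (- (2 * of_real pi * \<i> * of_real x * of_real \<xi>)))"

text \<open>Distributions are represented by their action on Schwartz functions; values on other
  arguments are irrelevant. The pairing of a function with a test function is bilinear (no complex
  conjugation).\<close>

definition dist_of_fun :: "(real \<Rightarrow> complex) \<Rightarrow> (real \<Rightarrow> complex) \<Rightarrow> complex" where
  "dist_of_fun g \<phi> = (LINT x|lebesgue. g x * \<phi> x)"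

definition fourier_dist :: "((real \<Rightarrow> complex) \<Rightarrow> complex) \<Rightarrow> (real \<Rightarrow> complex) \<Rightarrow> complex" where
  "fourier_dist T \<phi> = T (fourier \<phi>)"

definition represents :: "(real \<Rightarrow> complex) \<Rightarrow> ((real \<Rightarrow> complex) \<Rightarrow> complex) \<Rightarrow> bool" where
  "represents h T \<longleftrightarrow> (\<forall>\<phi>\<in>schwartz. T \<phi> = dist_of_fun h \<phi>)"

definition fourier_bounded :: "(real \<Rightarrow> ereal) \<Rightarrow> (real \<Rightarrow> ereal) \<Rightarrow> bool" where
  "fourier_bounded p q \<longleftrightarrow>
     (\<exists>C>0. \<forall>f\<in>Lvar p. \<exists>h\<in>Lvar q.
        represents h (fourier_dist (dist_of_fun f)) \<and> Lvar_norm q h \<le> C * Lvar_norm p f)"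

end

theory Submission
  imports Defs "HOL-Probability.Levy" "HOL-Probability.Distributions"
    "HOL-Computational_Algebra.Polynomial"
begin

text \<open>If the lengths do not tend to \<open>0\<close>, infinitely many of the intervals contain sets \<open>A\<^sub>j\<close> of measure
  at least \<open>\<delta> / 2\<close> and diameter at most \<open>\<delta>\<close> on which the bound on the exponent holds. For
  \<open>f = \<Sum>j<N. \<plusminus>1\<^bsub>A\<^sub>j\<^esub>\<close> each Fourier transform of \<open>1\<^bsub>A\<^sub>j\<^esub>\<close> is of size \<open>\<delta>\<close> on a fixed interval
  \<open>B\<close> around \<open>0\<close>, so by Khintchine's inequality some choice of signs makes the \<open>L\<^sup>1(B)\<close> norm of the
  transform of \<open>f\<close> at least \<open>c * sqrt N\<close>. In (i), \<open>f\<close> lives where \<open>p > 2 + \<epsilon>\<close>, so its norm is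
  \<open>O(N\<^bsup>1/(2+\<epsilon>)\<^esup>)\<close>, and the norm in the target space dominates the \<open>L\<^sup>1(B)\<close> norm. In (ii) the
  \<open>L\<^sup>1(B)\<close> norm is the integral over \<open>\<Union>j. A\<^sub>j\<close> of \<open>f\<close> times the transform of a function bounded by
  \<open>1\<^bsub>B\<^esub>\<close>, and it is \<open>O(N\<^bsup>1-1/r\<^esup>)\<close> with \<open>r < 2\<close> because \<open>q \<le> r\<close> on the \<open>A\<^sub>j\<close>.\<close>

section \<open>Khintchine's inequality\<close>

lemma norm_pm_sq:
  fixes z w :: complex
  shows "(norm (z + w))\<^sup>2 + (norm (z - w))\<^sup>2 = 2 * (norm z)\<^sup>2 + 2 * (norm w)\<^sup>2"
  unfolding cmod_power2 by (simp add: power2_eq_square algebra_simps)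

text \<open>Put \<open>R\<close> for the real part of \<open>z * cnj w\<close>. The parallelogram
  law gives the sum of the two squared norms, their difference is \<open>4 * R\<close>, and
  Cauchy-Schwarz bounds \<open>R\<^sup>2\<close>. The 6 is the binomial coefficient of the real
  case.\<close>

lemma norm_pm_fourth:
  fixes z w :: complex
  shows "(norm (z + w)) ^ 4 + (norm (z - w)) ^ 4
         \<le> 2 * ((norm z) ^ 4 + (norm w) ^ 4 + 6 * (norm z)\<^sup>2 * (norm w)\<^sup>2)"
proof -
  define P M A B where "P = (norm (z + w))\<^sup>2" and "M = (norm (z - w))\<^sup>2"
    and "A = (norm z)\<^sup>2" and "B = (norm w)\<^sup>2"
  have PM: "P + M = 2 * (A + B)"
    using norm_pm_sq[of z w] unfolding P_def M_def A_def B_def by simp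
  define R where "R = Re z * Re w + Im z * Im w"
  have dif: "P - M = 4 * R"
    unfolding P_def M_def R_def cmod_power2 by (simp add: power2_eq_square algebra_simps)
  have "A * B - R\<^sup>2 = (Re z * Im w - Im z * Re w)\<^sup>2"
    unfolding A_def B_def R_def cmod_power2 by (simp add: power2_eq_square algebra_simps)
  then have R: "R\<^sup>2 \<le> A * B"
    by (metis diff_ge_0_iff_ge zero_le_power2)
  have "2 * (P\<^sup>2 + M\<^sup>2) = (P + M)\<^sup>2 + (P - M)\<^sup>2"
    by (simp add: power2_eq_square algebra_simps)
  also have "\<dots> = 4 * (A + B)\<^sup>2 + 16 * R\<^sup>2"
    unfolding PM dif by (simp add: power2_eq_square algebra_simps)
  also have "\<dots> \<le> 4 * (A + B)\<^sup>2 + 16 * (A * B)"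
    using R by simp
  finally have "P\<^sup>2 + M\<^sup>2 \<le> 2 * (A\<^sup>2 + B\<^sup>2 + 6 * A * B)"
    by (simp add: power2_eq_square algebra_simps)
  moreover have "P\<^sup>2 = norm (z + w) ^ 4" "M\<^sup>2 = norm (z - w) ^ 4" "A\<^sup>2 = norm z ^ 4"
    unfolding P_def M_def A_def by simp_all
  moreover have "B\<^sup>2 = norm w ^ 4"
    unfolding B_def by simp
  ultimately show ?thesis
    unfolding A_def[symmetric] B_def[symmetric] by simp
qed

text \<open>The potential below is a lower bound for the expectation of
  \<open>\<alpha> * |G + \<Sum>j<m. \<plusminus>h\<^sub>j|\<^sup>2 - \<beta> * |G + \<Sum>j<m. \<plusminus>h\<^sub>j|\<^sup>4\<close> over independent uniform signs;
  each sign is chosen so that it does not decrease.\<close>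

definition sign_potential :: "real \<Rightarrow> real \<Rightarrow> real \<Rightarrow> nat \<Rightarrow> real \<Rightarrow> real" where
  "sign_potential a \<alpha> \<beta> m t =
     \<alpha> * (t\<^sup>2 + real m * a\<^sup>2) - \<beta> * (t ^ 4 + 6 * real m * t\<^sup>2 + 3 * (real m)\<^sup>2)"

text \<open>Averages over one sign: the second moment grows by |w|^2 >= a^2, the fourth by at most 6
  |z|^2 + 1. The coefficients 6 m and 3 m^2 absorb this, since 3 (m + 1)^2 = 3 m^2 + 6 m + 3 covers
  the 6 m from the quadratic term and the 1 from |w|^4.\<close>

lemma sign_potential_step:
  fixes z w :: complex
  assumes "0 \<le> \<alpha>" "0 \<le> \<beta>" "0 \<le> a" "a \<le> norm w" "norm w \<le> 1"
  shows "2 * sign_potential a \<alpha> \<beta> (Suc m) (norm z)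
         \<le> sign_potential a \<alpha> \<beta> m (norm (z + w)) + sign_potential a \<alpha> \<beta> m (norm (z - w))"
proof -
  define P M Z P4 M4 Z4 where "P = (norm (z + w))\<^sup>2" "M = (norm (z - w))\<^sup>2" "Z = (norm z)\<^sup>2"
    "P4 = norm (z + w) ^ 4" "M4 = norm (z - w) ^ 4" "Z4 = norm z ^ 4"
  note defs = this
  have w: "a\<^sup>2 \<le> (norm w)\<^sup>2" "(norm w)\<^sup>2 \<le> 1" "norm w ^ 4 \<le> 1"
    using assms by (simp_all add: power_mono power_le_one)
  have PM: "P + M = 2 * Z + 2 * (norm w)\<^sup>2"
    unfolding defs by (rule norm_pm_sq)
  define X where "X = Z * (norm w)\<^sup>2"
  have "X \<le> Z * 1"
    using w(2) unfolding defs X_def by (intro mult_left_mono) simp_all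
  moreover have "P4 + M4 \<le> 2 * (Z4 + (norm w) ^ 4 + 6 * X)"
    using norm_pm_fourth[of z w] unfolding defs X_def mult.assoc .
  ultimately have 4: "P4 + M4 \<le> 2 * Z4 + 2 + 12 * Z"
    using w(3) by (smt (verit))
  have 2: "real m * (P + M) \<le> real m * (2 * Z + 2)"
    using PM w(2) by (intro mult_left_mono) linarith+
  have "\<alpha> * (2 * Z + 2 * real (Suc m) * a\<^sup>2) \<le> \<alpha> * (P + M + 2 * real m * a\<^sup>2)"
    using PM w(1) assms(1) by (intro mult_left_mono) (simp_all add: distrib_right)
  moreover have "\<beta> * (P4 + M4 + 6 * (real m * (P + M)) + 6 * (real m)\<^sup>2)
      \<le> \<beta> * (2 * Z4 + 12 * real (Suc m) * Z + 6 * (real (Suc m))\<^sup>2)"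
  proof (rule mult_left_mono)
    have "12 * real (Suc m) * Z + 6 * (real (Suc m))\<^sup>2 
      = 12 * Z + 6 * (real m * (2 * Z + 2)) + 6 * (real m)\<^sup>2 + 6"
      by (simp add: power2_eq_square algebra_simps)
    then show "P4 + M4 + 6 * (real m * (P + M)) + 6 * (real m)\<^sup>2
      \<le> 2 * Z4 + 12 * real (Suc m) * Z + 6 * (real (Suc m))\<^sup>2"
      using 2 4 by linarith
  qed (rule assms(2))
  moreover have "2 * sign_potential a \<alpha> \<beta> (Suc m) (norm z)
      = \<alpha> * (2 * Z + 2 * real (Suc m) * a\<^sup>2)
        - \<beta> * (2 * Z4 + 12 * real (Suc m) * Z + 6 * (real (Suc m))\<^sup>2)"
    unfolding sign_potential_def defs[symmetric] by algebra
  moreover have "sign_potential a \<alpha> \<beta> m (norm (z + w)) + sign_potential a \<alpha> \<beta> m (norm (z - w))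
      = \<alpha> * (P + M + 2 * real m * a\<^sup>2) - \<beta> * (P4 + M4 + 6 * (real m * (P + M)) + 6 * (real m)\<^sup>2)"
    unfolding sign_potential_def defs[symmetric] by algebra
  ultimately show ?thesis
    by linarith
qed

text \<open>The method of conditional expectations: the integrals for the two values of a sign have
  a mean at least as large as the current one, so one value, the same for all \<open>x\<close>, does
  not lower it. \<open>G\<close> is arbitrary because it absorbs the terms whose signs are already
  fixed, from the highest index down.\<close>

lemma sign_potential_choice:
  fixes h :: "nat \<Rightarrow> real \<Rightarrow> complex"
  assumes "0 \<le> \<alpha>" "0 \<le> \<beta>" "0 \<le> a"
    and cont: "\<And>j. continuous_on {c..d} (h j)"
    and low: "\<And>j x. x \<in> {c..d} \<Longrightarrow> a \<le> norm (h j x)"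
    and up: "\<And>j x. x \<in> {c..d} \<Longrightarrow> norm (h j x) \<le> 1"
    and "continuous_on {c..d} G"
  shows "\<exists>s :: nat \<Rightarrow> real. (\<forall>j. s j \<in> {-1, 1}) \<and>
     integral {c..d} (\<lambda>x. sign_potential a \<alpha> \<beta> m (norm (G x)))
     \<le> integral {c..d} (\<lambda>x. sign_potential a \<alpha> \<beta> 0 (norm (G x + (\<Sum>j<m. s j *\<^sub>R h j x))))"
  using \<open>continuous_on {c..d} G\<close>
proof (induction m arbitrary: G)
  case 0
  then show ?case by (auto intro!: exI[of _ "\<lambda>_. 1"])
next
  case (Suc m)
  define I where "I = (\<lambda>G :: real \<Rightarrow> complex. \<lambda>n. integral {c..d} (\<lambda>x. sign_potential a \<alpha> \<beta> n (norm (G x))))"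
  have int: "(\<lambda>x. sign_potential a \<alpha> \<beta> n (norm (H x))) integrable_on {c..d}"
    if "continuous_on {c..d} H" for H :: "real \<Rightarrow> complex" and n
    unfolding sign_potential_def using that
    by (intro integrable_continuous_interval continuous_intros)
  have c: "continuous_on {c..d} (\<lambda>x. G x + h m x)" "continuous_on {c..d} (\<lambda>x. G x - h m x)"
    by (rule continuous_on_add[OF Suc.prems cont] continuous_on_diff[OF Suc.prems cont])+
  have "2 * I G (Suc m) \<le> I (\<lambda>x. G x + h m x) m + I (\<lambda>x. G x - h m x) m"
  proof -
    have "2 * I G (Suc m) = integral {c..d} (\<lambda>x. 2 * sign_potential a \<alpha> \<beta> (Suc m) (norm (G x)))"
      unfolding I_def by simp
    also have "\<dots> \<le> integral {c..d} (\<lambda>x. sign_potential a \<alpha> \<beta> m (norm (G x + h m x)) + sign_potential a \<alpha> \<beta> m (norm (G x - h m x)))"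
      using assms c Suc.prems by (intro integral_le sign_potential_step integrable_add int integrable_on_mult_right) auto
    also have "\<dots> = I (\<lambda>x. G x + h m x) m + I (\<lambda>x. G x - h m x) m"
      unfolding I_def using c by (intro integral_add int)
    finally show ?thesis .
  qed
  then have "I G (Suc m) \<le> I (\<lambda>x. G x + h m x) m \<or> I G (Suc m) \<le> I (\<lambda>x. G x - h m x) m"
    by linarith
  then obtain \<sigma> :: real where \<sigma>: "\<sigma> \<in> {-1, 1}" "I G (Suc m) \<le> I (\<lambda>x. G x + \<sigma> *\<^sub>R h m x) m"
  proof
    assume "I G (Suc m) \<le> I (\<lambda>x. G x + h m x) m"
    then show ?thesis by (intro that[of 1]) auto
  next
    assume "I G (Suc m) \<le> I (\<lambda>x. G x - h m x) m"
    then show ?thesis by (intro that[of "-1"]) auto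
  qed
  have "continuous_on {c..d} (\<lambda>x. G x + \<sigma> *\<^sub>R h m x)"
    by (rule continuous_on_add[OF Suc.prems continuous_on_scaleR[OF continuous_on_const cont]])
  from Suc.IH[OF this] obtain s :: "nat \<Rightarrow> real" where s: "\<forall>j. s j \<in> {-1, 1}"
    "I (\<lambda>x. G x + \<sigma> *\<^sub>R h m x) m \<le> I (\<lambda>x. (G x + \<sigma> *\<^sub>R h m x) + (\<Sum>j<m. s j *\<^sub>R h j x)) 0"
    unfolding I_def by blast
  have sum: "(G x + \<sigma> *\<^sub>R h m x) + (\<Sum>j<m. s j *\<^sub>R h j x) = G x + (\<Sum>j<Suc m. (s(m := \<sigma>)) j *\<^sub>R h j x)" for x
    by simp
  have "I G (Suc m) \<le> I (\<lambda>x. G x + (\<Sum>j<Suc m. (s(m := \<sigma>)) j *\<^sub>R h j x)) 0"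
    using order_trans[OF \<sigma>(2) s(2)] unfolding sum .
  moreover have "\<forall>j. (s(m := \<sigma>)) j \<in> {-1, 1}"
    using s(1) \<sigma>(1) by simp
  ultimately show ?case
    unfolding I_def by (intro exI[of _ "s(m := \<sigma>)"] conjI)
qed

text \<open>Instead of interpolating between the second and fourth moments, the potential is chosen
  below \<open>t\<close> pointwise when no signs remain, yet equal to
  \<open>a ^ 3 / 2 * sqrt (real N)\<close> when all \<open>N\<close> signs are still open.\<close>

lemma signs_large_L1:
  fixes h :: "nat \<Rightarrow> real \<Rightarrow> complex"
  assumes "0 < a" "c \<le> d"
    and cont: "\<And>j. continuous_on {c..d} (h j)"
    and low: "\<And>j x. x \<in> {c..d} \<Longrightarrow> a \<le> norm (h j x)"
    and up: "\<And>j x. x \<in> {c..d} \<Longrightarrow> norm (h j x) \<le> 1"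
  shows "\<exists>s :: nat \<Rightarrow> real. (\<forall>j. s j \<in> {-1, 1}) \<and>
     (d - c) * a ^ 3 / 2 * sqrt (real N) \<le> integral {c..d} (\<lambda>x. norm (\<Sum>j<N. s j *\<^sub>R h j x))"
proof (cases "N = 0")
  case True
  then show ?thesis by (auto intro!: exI[of _ "\<lambda>_. 1"])
next
  case False
  define r where "r = sqrt (real N)"
  have r: "r > 0" "real N = r\<^sup>2" using False by (auto simp: r_def)
  \<comment> \<open>With \<open>y = a * t / r\<close> the potential without open signs is
    \<open>t * (y - y ^ 3 / 6)\<close>. At \<open>t = 0\<close> with \<open>N\<close> open signs,
    the quadratic part gives \<open>a ^ 3 * r\<close> and the quartic part takes away half of
    it.\<close>
  define \<alpha> \<beta> where "\<alpha> = a / r" and "\<beta> = a ^ 3 / (6 * r ^ 3)"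
  have "0 \<le> \<alpha>" "0 \<le> \<beta>" using assms r by (auto simp: \<alpha>_def \<beta>_def)
  then obtain s :: "nat \<Rightarrow> real" where s: "\<forall>j. s j \<in> {-1, 1}"
     "integral {c..d} (\<lambda>x. sign_potential a \<alpha> \<beta> N (norm (0::complex)))
     \<le> integral {c..d} (\<lambda>x. sign_potential a \<alpha> \<beta> 0 (norm (0 + (\<Sum>j<N. s j *\<^sub>R h j x))))"
    using sign_potential_choice[of \<alpha> \<beta> a c d h "\<lambda>_. 0" N] assms by auto
  have pw: "sign_potential a \<alpha> \<beta> 0 t \<le> t" if "t \<ge> 0" for t
  proof -
    define y where "y = a * t / r"
    have y: "y \<ge> 0" using that assms r by (simp add: y_def)
    have "y - y ^ 3 / 6 \<le> 1"
    proof (cases "y \<le> 1")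
      case True
      then show ?thesis using y by (smt (verit) divide_nonneg_nonneg zero_le_power)
    next
      case False
      \<comment> \<open>The tangent to \<open>y ^ 3\<close> at \<open>3/2\<close> is
        \<open>27/4 * (y - 1)\<close>; a sixth of it exceeds \<open>y - 1\<close> for
        \<open>y > 1\<close>.\<close>
      have "0 \<le> (y - 3/2)\<^sup>2 * (y + 3)" using y by simp
      also have "\<dots> = y ^ 3 - 27/4 * y + 27/4"
        by (simp add: power2_eq_square power3_eq_cube algebra_simps)
      finally show ?thesis using False by simp
    qed
    then have "t * (y - y ^ 3 / 6) \<le> t" using that by (simp add: mult_left_le)
    also have "t * (y - y ^ 3 / 6) = sign_potential a \<alpha> \<beta> 0 t"
      unfolding sign_potential_def y_def \<alpha>_def \<beta>_def using r
      by (simp add: field_simps power2_eq_square power3_eq_cube power4_eq_xxxx)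
    finally show ?thesis .
  qed
  have "sign_potential a \<alpha> \<beta> N 0 = a ^ 3 / 2 * r"
    unfolding sign_potential_def \<alpha>_def \<beta>_def r(2) using r
    by (simp add: field_simps power2_eq_square power3_eq_cube power4_eq_xxxx)
  then have "(d - c) * a ^ 3 / 2 * r = integral {c..d} (\<lambda>x. sign_potential a \<alpha> \<beta> N (norm (0::complex)))"
    using \<open>c \<le> d\<close> by simp
  also have "\<dots> \<le> integral {c..d} (\<lambda>x. sign_potential a \<alpha> \<beta> 0 (norm (\<Sum>j<N. s j *\<^sub>R h j x)))"
    using s(2) by simp
  also have "\<dots> \<le> integral {c..d} (\<lambda>x. norm (\<Sum>j<N. s j *\<^sub>R h j x))"
  proof (rule integral_le)
    show "(\<lambda>x. sign_potential a \<alpha> \<beta> 0 (norm (\<Sum>j<N. s j *\<^sub>R h j x))) integrable_on {c..d}"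
      unfolding sign_potential_def by (intro integrable_continuous_interval continuous_intros cont)
    show "(\<lambda>x. norm (\<Sum>j<N. s j *\<^sub>R h j x)) integrable_on {c..d}"
      by (intro integrable_continuous_interval continuous_intros cont)
  qed (simp add: pw)
  finally show ?thesis using s(1) r_def by blast
qed

section \<open>The Fourier transform of integrable functions\<close>

abbreviation fourier_kernel :: "real \<Rightarrow> real \<Rightarrow> complex" where
  "fourier_kernel x \<xi> \<equiv> exp (- (2 * of_real pi * \<i> * of_real x * of_real \<xi>))"

lemma norm_fourier_kernel: "norm (fourier_kernel x \<xi>) = 1"
  by (simp add: norm_exp_eq_Re)

lemma borel_measurable_fourier_kernel_pair:
  "(\<lambda>p. fourier_kernel (fst p) (snd p)) \<in> borel_measurable (lborel \<Otimes>\<^sub>M lborel)"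
proof -
  have "(\<lambda>p. fourier_kernel (fst p) (snd p)) \<in> borel_measurable borel"
    by (intro borel_measurable_continuous_onI continuous_intros)
  also have "borel_measurable (borel :: (real \<times> real) measure) = borel_measurable (lborel \<Otimes>\<^sub>M lborel)"
    by (intro measurable_cong_sets) (simp_all add: borel_prod[symmetric])
  finally show ?thesis .
qed

lemma borel_measurable_fourier_kernel [measurable]: "(\<lambda>x. fourier_kernel x \<xi>) \<in> borel_measurable borel"
  by (intro borel_measurable_continuous_onI continuous_intros)

lemma integrable_fourier_kernel:
  assumes "integrable lborel f"
  shows "integrable lborel (\<lambda>x. f x * fourier_kernel x \<xi>)"
proof (rule Bochner_Integration.integrable_bound[OF assms])
  show "(\<lambda>x. f x * fourier_kernel x \<xi>) \<in> borel_measurable lborel"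
    using borel_measurable_integrable[OF assms] by measurable
qed (simp add: norm_mult norm_fourier_kernel)

lemma fourier_lborel:
  assumes "integrable lborel f"
  shows "fourier f \<xi> = (LINT x|lborel. f x * fourier_kernel x \<xi>)"
  unfolding fourier_def
  using borel_measurable_integrable[OF integrable_fourier_kernel[OF assms]] by (intro integral_completion)

lemma norm_fourier_le:
  assumes "integrable lborel f"
  shows "norm (fourier f \<xi>) \<le> (LINT x|lborel. norm (f x))"
proof -
  have "norm (fourier f \<xi>) \<le> (LINT x|lborel. norm (f x * fourier_kernel x \<xi>))"
    unfolding fourier_lborel[OF assms] by (rule integral_norm_bound)
  then show ?thesis by (simp add: norm_mult norm_fourier_kernel)
qed

lemma continuous_on_fourier:
  assumes f: "integrable lborel f"
  shows "continuous_on A (fourier f)"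
proof (rule continuous_on_subset[of UNIV])
  have "isCont (fourier f) \<xi>" for \<xi>
  proof (rule continuous_at_sequentiallyI)
    fix u assume u: "u \<longlonglongrightarrow> \<xi>"
    show "(\<lambda>n. fourier f (u n)) \<longlonglongrightarrow> fourier f \<xi>"
      unfolding fourier_lborel[OF f]
    proof (rule integral_dominated_convergence)
      show "AE x in lborel. (\<lambda>n. f x * fourier_kernel x (u n)) \<longlonglongrightarrow> f x * fourier_kernel x \<xi>"
        by (intro AE_I2 tendsto_intros u)
      show "integrable lborel (\<lambda>x. norm (f x))"
        using f by simp
      show "(\<lambda>x. f x * fourier_kernel x \<xi>) \<in> borel_measurable lborel"
        and "\<And>n. (\<lambda>x. f x * fourier_kernel x (u n)) \<in> borel_measurable lborel"
        by (rule borel_measurable_integrable[OF integrable_fourier_kernel[OF f]])+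
    qed (simp add: norm_mult norm_fourier_kernel)
  qed
  then show "continuous_on UNIV (fourier f)"
    by (simp add: continuous_on_eq_continuous_at)
qed simp

lemma borel_measurable_fourier:
  assumes "integrable lborel f"
  shows "fourier f \<in> borel_measurable borel"
  by (intro borel_measurable_continuous_onI continuous_on_fourier assms)

lemma fourier_sum:
  assumes "\<And>j. j \<in> I \<Longrightarrow> integrable lborel (f j)"
  shows "fourier (\<lambda>x. \<Sum>j\<in>I. s j *\<^sub>R f j x) \<xi> = (\<Sum>j\<in>I. s j *\<^sub>R fourier (f j) \<xi>)"
proof -
  have "integrable lborel (\<lambda>x. \<Sum>j\<in>I. s j *\<^sub>R f j x)"
    using assms by (intro Bochner_Integration.integrable_sum integrable_scaleR_right) auto
  then have "fourier (\<lambda>x. \<Sum>j\<in>I. s j *\<^sub>R f j x) \<xi> = (LINT x|lborel. (\<Sum>j\<in>I. s j *\<^sub>R (f j x * fourier_kernel x \<xi>)))"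
    by (simp add: fourier_lborel sum_distrib_right)
  also have "\<dots> = (\<Sum>j\<in>I. LINT x|lborel. s j *\<^sub>R (f j x * fourier_kernel x \<xi>))"
    using assms by (intro Bochner_Integration.integral_sum integrable_scaleR_right integrable_fourier_kernel)
  also have "\<dots> = (\<Sum>j\<in>I. s j *\<^sub>R fourier (f j) \<xi>)"
    using assms by (intro sum.cong) (simp_all add: fourier_lborel)
  finally show ?thesis .
qed

lemma integrable_mult_fourier:
  assumes "integrable lborel f" "integrable lborel g"
  shows "integrable lborel (\<lambda>x. f x * fourier g x)"
proof (rule Bochner_Integration.integrable_bound)
  show "integrable lborel (\<lambda>x. norm (f x) * (LINT x|lborel. norm (g x)))"
    using assms by simp
  show "(\<lambda>x. f x * fourier g x) \<in> borel_measurable lborel"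
    using borel_measurable_integrable[OF assms(1)] borel_measurable_fourier[OF assms(2)] by simp
  show "AE x in lborel. norm (f x * fourier g x) \<le> norm (norm (f x) * (LINT x|lborel. norm (g x)))"
    by (intro AE_I2) (auto simp: norm_mult abs_mult intro!: mult_left_mono norm_fourier_le assms
        order_trans[OF _ abs_ge_self])
qed

text \<open>Fubini applied to f(x) g(y) times the kernel, which has modulus 1 and is symmetric in
  its arguments. It serves to evaluate distributional transforms and, in (ii), as the duality
  step.\<close>

lemma fourier_multiplication:
  assumes f: "integrable lborel f" and g: "integrable lborel g"
  shows "(LINT x|lborel. f x * fourier g x) = (LINT x|lborel. fourier f x * g x)"
proof -
  have [measurable]: "f \<in> borel_measurable lborel" "g \<in> borel_measurable lborel"
    using f g by auto
  note [measurable] = borel_measurable_fourier_kernel_pair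
  have int: "integrable (lborel \<Otimes>\<^sub>M lborel) (\<lambda>p. f (fst p) * g (snd p) * fourier_kernel (fst p) (snd p))"
  proof (rule lborel_pair.Fubini_integrable)
    show "(\<lambda>p. f (fst p) * g (snd p) * fourier_kernel (fst p) (snd p)) \<in> borel_measurable (lborel \<Otimes>\<^sub>M lborel)"
      by measurable
    show "integrable lborel (\<lambda>x. LINT y|lborel. norm (f (fst (x, y)) * g (snd (x, y)) * fourier_kernel (fst (x, y)) (snd (x, y))))"
      using f by (simp add: norm_mult norm_fourier_kernel)
    show "AE x in lborel. integrable lborel (\<lambda>y. f (fst (x, y)) * g (snd (x, y)) * fourier_kernel (fst (x, y)) (snd (x, y)))"
    proof (intro AE_I2)
      fix x :: real
      have "integrable lborel (\<lambda>y. f x * (g y * fourier_kernel y x))"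
        by (intro integrable_mult_right integrable_fourier_kernel g)
      then show "integrable lborel (\<lambda>y. f (fst (x, y)) * g (snd (x, y)) * fourier_kernel (fst (x, y)) (snd (x, y)))"
        by (simp add: mult_ac)
    qed
  qed
  have "(LINT x|lborel. f x * fourier g x) = (LINT x|lborel. LINT y|lborel. f x * g y * fourier_kernel x y)"
  proof (rule Bochner_Integration.integral_cong)
    fix x :: real
    have "f x * fourier g x = (LINT y|lborel. f x * (g y * fourier_kernel y x))"
      by (simp add: fourier_lborel[OF g])
    then show "f x * fourier g x = (LINT y|lborel. f x * g y * fourier_kernel x y)"
      by (simp add: mult_ac)
  qed simp
  also have "\<dots> = (LINT y|lborel. LINT x|lborel. f x * g y * fourier_kernel x y)"
    using int by (intro lborel_pair.Fubini_integral[symmetric]) (simp add: case_prod_beta')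
  also have "\<dots> = (LINT y|lborel. fourier f y * g y)"
  proof (rule Bochner_Integration.integral_cong)
    fix y :: real
    have "fourier f y * g y = (LINT x|lborel. (f x * fourier_kernel x y) * g y)"
      by (simp add: fourier_lborel[OF f])
    then show "(LINT x|lborel. f x * g y * fourier_kernel x y) = fourier f y * g y"
      by (simp add: mult_ac)
  qed simp
  finally show ?thesis .
qed

section \<open>Uniqueness for the Fourier transform\<close>

text \<open>The value at \<open>t = 0\<close> shows that the positive and negative parts of
  \<open>g\<close> have the same mass \<open>c\<close>. If \<open>c > 0\<close>, dividing by
  \<open>c\<close> makes them probability densities with equal characteristic functions, and Levy's
  uniqueness theorem identifies them.\<close>

lemma AE_zero_if_fourier_zero_real:
  fixes g :: "real \<Rightarrow> real"
  assumes g: "integrable lborel g"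
    and zero: "\<And>t. (LINT x|lborel. g x * iexp (t * x)) = 0"
  shows "AE x in lborel. g x = 0"
proof -
  define P M where "P = (\<lambda>x. max 0 (g x))" and "M = (\<lambda>x. max 0 (- g x))"
  have gPM: "g x = P x - M x" for x by (simp add: P_def M_def)
  have [simp]: "0 \<le> P x" "0 \<le> M x" for x by (simp_all add: P_def M_def)
  have iP: "integrable lborel P" and iM: "integrable lborel M"
    unfolding P_def M_def using g by auto
  have [measurable]: "P \<in> borel_measurable borel" "M \<in> borel_measurable borel"
    using iP iM by auto
  define c where "c = (LINT x|lborel. P x)"
  have "(LINT x|lborel. complex_of_real (g x)) = 0"
    using zero[of 0] by simp
  then have "(LINT x|lborel. g x) = 0"
    by simp
  then have cM: "c = (LINT x|lborel. M x)"
    unfolding c_def gPM using iP iM by simp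
  show ?thesis
  proof (cases "c = 0")
    case True
    have "AE x in lborel. P x = 0"
      using integral_nonneg_eq_0_iff_AE[OF iP] True unfolding c_def by simp
    moreover have "AE x in lborel. M x = 0"
      using integral_nonneg_eq_0_iff_AE[OF iM] True unfolding cM by simp
    ultimately
    show ?thesis by eventually_elim (simp add: gPM)
  next
    case False
    then have c: "c > 0" unfolding c_def by (simp add: order.not_eq_order_implies_strict)
    define D where "D = (\<lambda>u :: real \<Rightarrow> real. density lborel (\<lambda>x. ennreal (u x / c)))"
    have D: "real_distribution (D u)"
        and charD: "char (D u) t = (LINT x|lborel. u x * iexp (t * x)) / c"
      if u: "integrable lborel u" "\<And>x. 0 \<le> u x" "c = (LINT x|lborel. u x)" for u t
    proof -
      have [measurable]: "u \<in> borel_measurable borel" using u(1) by auto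
      have "emeasure (D u) (space (D u)) = (\<integral>\<^sup>+x. ennreal (u x / c) \<partial>lborel)"
        unfolding D_def by (simp add: emeasure_density)
      also have "\<dots> = ennreal (LINT x|lborel. u x / c)"
        using u c by (intro nn_integral_eq_integral) auto
      also have "(LINT x|lborel. u x / c) = 1"
        using u(3) c by simp
      finally have "prob_space (D u)" by (intro prob_spaceI) simp
      moreover have "sets (D u) = sets borel" by (simp add: D_def)
      ultimately show "real_distribution (D u)"
        by (intro real_distribution.intro real_distribution_axioms.intro) simp_all
      have "char (D u) t = (LINT x|lborel. (u x / c) *\<^sub>R iexp (t * x))"
        unfolding char_def D_def using u c by (intro integral_density) auto
      also have "\<dots> = (LINT x|lborel. (u x * iexp (t * x)) / c)"
        by (intro Bochner_Integration.integral_cong) (simp_all add: scaleR_conv_of_real)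
      finally show "char (D u) t = (LINT x|lborel. u x * iexp (t * x)) / c"
        by simp
    qed
    have iexp_int: "integrable lborel (\<lambda>x. complex_of_real (u x) * iexp (t * x))"
      if u: "integrable lborel u" for u t
    proof (rule Bochner_Integration.integrable_bound[OF u])
      have [measurable]: "u \<in> borel_measurable borel" using u(1) by auto
      show "(\<lambda>x. complex_of_real (u x) * iexp (t * x)) \<in> borel_measurable lborel"
        by measurable
    qed (simp add: norm_mult)
    have "char (D P) = char (D M)"
    proof
      fix t
      have "(LINT x|lborel. P x * iexp (t * x)) - (LINT x|lborel. M x * iexp (t * x))
          = (LINT x|lborel. P x * iexp (t * x) - M x * iexp (t * x))"
        by (intro Bochner_Integration.integral_diff[symmetric] iexp_int iP iM)
      also have "\<dots> = (LINT x|lborel. g x * iexp (t * x))"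
        by (simp add: gPM algebra_simps)
      finally have "(LINT x|lborel. P x * iexp (t * x)) = (LINT x|lborel. M x * iexp (t * x))"
        using zero[of t] by simp
      then show "char (D P) t = char (D M) t"
        using charD[OF iP _ c_def] charD[OF iM _ cM] by simp
    qed
    then have "D P = D M"
      using D[OF iP _ c_def] D[OF iM _ cM] by (intro Levy_uniqueness) auto
    then have "AE x in lborel. ennreal (P x / c) = ennreal (M x / c)"
      unfolding D_def by (intro sigma_finite_measure.density_unique[OF lborel.sigma_finite_measure_axioms]) auto
    then show ?thesis
      by eventually_elim (use c in \<open>simp add: gPM\<close>)
  qed
qed

text \<open>Conjugating the hypothesis at \<open>- t\<close> gives the same vanishing for
  \<open>cnj (g x)\<close>, hence for the real and imaginary parts, to which the real case
  applies.\<close>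

lemma AE_zero_if_fourier_zero:
  fixes g :: "real \<Rightarrow> complex"
  assumes g: "integrable lborel g"
    and zero: "\<And>t. (LINT x|lborel. g x * iexp (t * x)) = 0"
  shows "AE x in lborel. g x = 0"
proof -
  have [measurable]: "g \<in> borel_measurable borel" using g by auto
  have [measurable]: "(\<lambda>x. cnj (g x)) \<in> borel_measurable borel"
    by (rule measurable_compose[OF _ borel_measurable_continuous_onI[OF continuous_on_cnj[OF continuous_on_id]]])
      measurable
  have int: "integrable lborel (\<lambda>x. g x * iexp (t * x))" for t
    by (rule Bochner_Integration.integrable_bound[OF g]) (auto simp: norm_mult)
  have int': "integrable lborel (\<lambda>x. cnj (g x) * iexp (t * x))" for t
    by (rule Bochner_Integration.integrable_bound[OF g]) (auto simp: norm_mult)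
  have zero': "(LINT x|lborel. cnj (g x) * iexp (t * x)) = 0" for t
  proof -
    have "(LINT x|lborel. cnj (g x) * iexp (t * x)) = (LINT x|lborel. cnj (g x * iexp (- t * x)))"
      by (intro Bochner_Integration.integral_cong) (simp_all add: exp_cnj)
    also have "\<dots> = cnj (LINT x|lborel. g x * iexp (- t * x))"
      by (rule Bochner_Integration.integral_cnj)
    finally show ?thesis using zero[of "- t"] by simp
  qed
  have "AE x in lborel. Re (g x) = 0"
  proof (rule AE_zero_if_fourier_zero_real)
    fix t
    have "(LINT x|lborel. complex_of_real (Re (g x)) * iexp (t * x))
       = (LINT x|lborel. (g x * iexp (t * x) + cnj (g x) * iexp (t * x)) / 2)"
      by (intro Bochner_Integration.integral_cong)
        (simp_all add: distrib_right[symmetric] complex_add_cnj)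
    also have "\<dots> = 0"
      using zero[of t] zero'[of t] int int' by simp
    finally show "(LINT x|lborel. complex_of_real (Re (g x)) * iexp (t * x)) = 0" .
  qed (use g in simp)
  moreover have "AE x in lborel. Im (g x) = 0"
  proof (rule AE_zero_if_fourier_zero_real)
    fix t
    have "(LINT x|lborel. complex_of_real (Im (g x)) * iexp (t * x))
       = (LINT x|lborel. (g x * iexp (t * x) - cnj (g x) * iexp (t * x)) / (2 * \<i>))"
    proof (intro Bochner_Integration.integral_cong refl)
      fix x
      have "complex_of_real (Im (g x)) = (g x - cnj (g x)) / (2 * \<i>)"
        by (simp add: complex_diff_cnj mult.commute)
      then show "complex_of_real (Im (g x)) * iexp (t * x)
          = (g x * iexp (t * x) - cnj (g x) * iexp (t * x)) / (2 * \<i>)"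
        by (simp only: left_diff_distrib times_divide_eq_left)
    qed
    also have "\<dots> = 0"
      using zero[of t] zero'[of t] int int' by simp
    finally show "(LINT x|lborel. complex_of_real (Im (g x)) * iexp (t * x)) = 0" .
  qed (use g in simp)
  ultimately show ?thesis
    by eventually_elim (simp add: complex_eq_iff)
qed

section \<open>Modulated Gaussians as Schwartz functions\<close>

text \<open>The polynomial factor makes the family closed under differentiation, so that one bound
  covers all derivatives of the test functions \<open>gauss_poly t 1\<close>.\<close>

definition gauss_poly :: "real \<Rightarrow> complex poly \<Rightarrow> real \<Rightarrow> complex" where
  "gauss_poly t P x = poly P (of_real x) * exp (- (of_real x)\<^sup>2 / 2 + \<i> * of_real t * of_real x)"

lemma norm_gauss_exp:
  "norm (exp (- (of_real x)\<^sup>2 / 2 + \<i> * of_real t * of_real x) :: complex) = exp (- x\<^sup>2 / 2)"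
  by (simp add: norm_exp_eq_Re power2_eq_square)

text \<open>The linear polynomial is the logarithmic derivative of the exponential factor. The
  derivative is computed for the entire function of \<open>z\<close> and restricted to the real
  line.\<close>

lemma has_vector_derivative_gauss_poly:
  "(gauss_poly t P has_vector_derivative gauss_poly t (pderiv P + [:\<i> * of_real t, -1:] * P) x) (at x)"
proof -
  have "((\<lambda>z. poly P z * exp (- z\<^sup>2 / 2 + \<i> * of_real t * z)) has_field_derivative
      gauss_poly t (pderiv P + [:\<i> * of_real t, -1:] * P) x) (at (of_real x))"
    unfolding gauss_poly_def
    by (auto intro!: derivative_eq_intros poly_DERIV simp: algebra_simps)
  then show ?thesis
    unfolding gauss_poly_def[abs_def] by (rule has_vector_derivative_real_field)
qed

lemma nth_deriv_gauss_poly: "\<exists>Q. nth_deriv n (gauss_poly t P) = gauss_poly t Q"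
proof (induction n)
  case 0
  then show ?case by (auto simp: nth_deriv_def)
next
  case (Suc n)
  then obtain Q where "nth_deriv n (gauss_poly t P) = gauss_poly t Q" by blast
  then have "nth_deriv (Suc n) (gauss_poly t P) = (\<lambda>x. vector_derivative (gauss_poly t Q) (at x))"
    by (simp add: nth_deriv_def)
  also have "\<dots> = gauss_poly t (pderiv Q + [:\<i> * of_real t, -1:] * Q)"
    by (intro ext vector_derivative_at has_vector_derivative_gauss_poly)
  finally show ?case by blast
qed

text \<open>A single term of the exponential series gives |x|^k <= k! exp |x|, and completing the
  square bounds the exponent |x| - x^2 / 2 by 1/2.\<close>

lemma power_mult_gauss_le: "\<bar>x\<bar> ^ k * exp (- x\<^sup>2 / 2) \<le> fact k * exp (1 / 2)" for x :: real
proof -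
  have "\<bar>x\<bar> ^ k / fact k \<le> exp \<bar>x\<bar>"
  proof -
    have "(\<Sum>n\<in>{k}. \<bar>x\<bar> ^ n /\<^sub>R fact n) \<le> exp \<bar>x\<bar>"
      unfolding exp_def by (intro sum_le_suminf summable_exp_generic) auto
    then show ?thesis by (simp add: divide_inverse mult.commute)
  qed
  then have "\<bar>x\<bar> ^ k * exp (- x\<^sup>2 / 2) \<le> (fact k * exp \<bar>x\<bar>) * exp (- x\<^sup>2 / 2)"
    by (intro mult_right_mono) (simp_all add: field_simps)
  also have "\<dots> = fact k * exp (\<bar>x\<bar> - x\<^sup>2 / 2)"
    by (simp add: mult_exp_exp)
  also have "\<dots> \<le> fact k * exp (1 / 2)"
  proof -
    have "0 \<le> (\<bar>x\<bar> - 1)\<^sup>2" by simp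
    then have "\<bar>x\<bar> - x\<^sup>2 / 2 \<le> 1 / 2" by (simp add: power2_eq_square algebra_simps)
    then show ?thesis by simp
  qed
  finally show ?thesis .
qed

text \<open>Induction on the coefficients: \<open>pCons a P\<close> stands for \<open>a\<close> plus
  \<open>x\<close> times \<open>P\<close>, and the extra factor \<open>x\<close> is moved into the
  power, so \<open>m\<close> has to vary.\<close>

lemma bounded_power_gauss_poly: "bounded (range (\<lambda>x. x ^ m *\<^sub>R gauss_poly t P x))"
proof (induction P arbitrary: m)
  case 0
  then show ?case by (simp add: gauss_poly_def)
next
  case (pCons a P)
  obtain B where B: "\<And>x. norm (x ^ Suc m *\<^sub>R gauss_poly t P x) \<le> B"
    using pCons.IH[of "Suc m"] unfolding bounded_iff by auto
  have "norm (x ^ m *\<^sub>R gauss_poly t (pCons a P) x) \<le> norm a * (fact m * exp (1 / 2)) + B" for x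
  proof -
    define E where "E = (exp (- (of_real x)\<^sup>2 / 2 + \<i> * of_real t * of_real x) :: complex)"
    have "x ^ m *\<^sub>R gauss_poly t (pCons a P) x = a * (x ^ m *\<^sub>R E) + x ^ Suc m *\<^sub>R gauss_poly t P x"
      by (simp add: gauss_poly_def E_def scaleR_conv_of_real algebra_simps)
    also have "norm \<dots> \<le> norm a * (\<bar>x\<bar> ^ m * exp (- x\<^sup>2 / 2)) + B"
      using B[of x] norm_gauss_exp[of x t]
      by (intro order_trans[OF norm_triangle_ineq] add_mono) (simp_all add: norm_mult E_def power_abs)
    also have "\<dots> \<le> norm a * (fact m * exp (1 / 2)) + B"
      by (intro add_mono mult_left_mono power_mult_gauss_le) auto
    finally show ?thesis .
  qed
  then show ?case unfolding bounded_iff by auto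
qed

lemma gauss_poly_schwartz: "gauss_poly t P \<in> schwartz"
proof -
  have "nth_deriv n (gauss_poly t P) differentiable at x
      \<and> bounded (range (\<lambda>x. x ^ m *\<^sub>R nth_deriv n (gauss_poly t P) x))" for m n x
  proof -
    obtain Q where "nth_deriv n (gauss_poly t P) = gauss_poly t Q"
      using nth_deriv_gauss_poly by blast
    then show ?thesis
      using has_vector_derivative_gauss_poly[of t Q x] bounded_power_gauss_poly
      by (auto intro: differentiableI_vector)
  qed
  then show ?thesis unfolding schwartz_def by blast
qed

lemma integrable_gauss: "integrable lborel (\<lambda>x :: real. exp (- x\<^sup>2 / 2))"
proof -
  have "integrable lborel (\<lambda>x. sqrt (2 * pi) * std_normal_density x)"
    by (intro integrable_mult_right) simp
  then show ?thesis by (simp add: std_normal_density_def)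
qed

section \<open>Distributional transforms of integrable functions\<close>

text \<open>Lets integrals over \<open>lebesgue\<close> be computed over \<open>lborel\<close>,
  where the uniqueness result is stated.\<close>

lemma lebesgue_borel_representative:
  fixes h :: "real \<Rightarrow> complex"
  assumes "h \<in> borel_measurable lebesgue"
  obtains h' where "h' \<in> borel_measurable borel" "AE x in lebesgue. h x = h' x"
proof -
  have "(\<lambda>x. Re (h x)) \<in> borel_measurable lebesgue" "(\<lambda>x. Im (h x)) \<in> borel_measurable lebesgue"
    using assms by (simp_all add: borel_measurable_Re borel_measurable_Im)
  then obtain u v where uv: "u \<in> borel_measurable lborel" "AE x in lborel. Re (h x) = u x"
      "v \<in> borel_measurable lborel" "AE x in lborel. Im (h x) = v x"
    using completion_ex_borel_measurable_real by metis
  have "(\<lambda>x. Complex (u x) (v x)) \<in> borel_measurable borel"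
    using uv by (simp add: borel_measurable_complex_iff)
  moreover have "AE x in lborel. h x = Complex (u x) (v x)"
    using uv(2,4) by eventually_elim (simp add: complex_eq_iff)
  then have "AE x in lebesgue. h x = Complex (u x) (v x)"
    by (rule AE_completion)
  ultimately show thesis by (rule that)
qed

text \<open>The test functions \<open>exp (- x\<^sup>2 / 2 + \<i> t x)\<close> turn the distributional identity into the
  vanishing of the Fourier transform of \<open>(h - fourier f) exp (- x\<^sup>2 / 2)\<close>.\<close>

lemma represents_fourier_AE:
  assumes f: "integrable lborel f"
    and h: "h \<in> borel_measurable lebesgue"
    and fin: "(\<integral>\<^sup>+x. ennreal (norm (h x) * exp (- x\<^sup>2 / 2)) \<partial>lebesgue) < \<infinity>"
    and rep: "represents h (fourier_dist (dist_of_fun f))"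
  shows "AE x in lebesgue. h x = fourier f x"
proof -
  obtain h' where h': "h' \<in> borel_measurable borel" and hh': "AE x in lebesgue. h x = h' x"
    using lebesgue_borel_representative[OF h] .
  note [measurable] = h' borel_measurable_fourier[OF f]
  define \<phi> where "\<phi> = (\<lambda>t. gauss_poly t 1)"
  have \<phi>: "\<phi> t \<in> schwartz" for t
    unfolding \<phi>_def by (rule gauss_poly_schwartz)
  have norm\<phi>: "norm (\<phi> t x) = exp (- x\<^sup>2 / 2)" for t x
    unfolding \<phi>_def gauss_poly_def using norm_gauss_exp[of x t] by simp
  have \<phi>_eq: "\<phi> t x = of_real (exp (- x\<^sup>2 / 2)) * iexp (t * x)" for t x
  proof -
    have "complex_of_real (exp (- x\<^sup>2 / 2)) = exp (- (of_real x)\<^sup>2 / 2)"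
      by (simp add: exp_of_real[symmetric])
    then show ?thesis
      unfolding \<phi>_def gauss_poly_def by (simp add: mult_exp_exp mult.assoc)
  qed
  have [measurable]: "\<phi> t \<in> borel_measurable borel" for t
    unfolding \<phi>_eq[abs_def] by measurable
  have int\<phi>: "integrable lborel (\<phi> t)" for t
    by (rule Bochner_Integration.integrable_bound[OF integrable_gauss]) (auto simp: norm\<phi>)
  have hint: "integrable lborel (\<lambda>x. h' x * \<phi> t x)" for t
  proof (rule integrableI_bounded)
    have "(\<integral>\<^sup>+x. ennreal (norm (h' x * \<phi> t x)) \<partial>lborel)
        = (\<integral>\<^sup>+x. ennreal (norm (h' x) * exp (- x\<^sup>2 / 2)) \<partial>lebesgue)"
      by (simp add: norm_mult norm\<phi> nn_integral_completion)
    also have "\<dots> = (\<integral>\<^sup>+x. ennreal (norm (h x) * exp (- x\<^sup>2 / 2)) \<partial>lebesgue)"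
      using hh' by (intro nn_integral_cong_AE) auto
    finally show "(\<integral>\<^sup>+x. ennreal (norm (h' x * \<phi> t x)) \<partial>lborel) < \<infinity>"
      using fin by simp
  qed simp
  have fint: "integrable lborel (\<lambda>x. fourier f x * \<phi> t x)" for t
    using integrable_mult_fourier[OF int\<phi> f] by (simp add: mult.commute)
  define g where "g = (\<lambda>x. (h' x - fourier f x) * of_real (exp (- x\<^sup>2 / 2)))"
  have g_eq: "g x * iexp (t * x) = h' x * \<phi> t x - fourier f x * \<phi> t x" for t x
    unfolding g_def \<phi>_eq by (simp add: algebra_simps)
  have "AE x in lborel. g x = 0"
  proof (rule AE_zero_if_fourier_zero)
    have "integrable lborel (\<lambda>x. h' x * \<phi> 0 x - fourier f x * \<phi> 0 x)"
      by (intro Bochner_Integration.integrable_diff hint fint)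
    then show "integrable lborel g"
      unfolding g_eq[of _ 0, symmetric] by simp
    fix t
    \<comment> \<open>By the multiplication formula this pairing is the distributional transform of
      \<open>f\<close> tested on \<open>\<phi> t\<close>, which by hypothesis is the pairing with
      \<open>h\<close>.\<close>
    have "(LINT x|lborel. fourier f x * \<phi> t x) = (LINT x|lborel. f x * fourier (\<phi> t) x)"
      by (rule fourier_multiplication[OF f int\<phi>, symmetric])
    also have "\<dots> = fourier_dist (dist_of_fun f) (\<phi> t)"
      unfolding fourier_dist_def dist_of_fun_def
      using borel_measurable_integrable[OF integrable_mult_fourier[OF f int\<phi>]]
      by (intro integral_completion[symmetric])
    also have "\<dots> = (LINT x|lebesgue. h x * \<phi> t x)"
      using rep \<phi> unfolding represents_def dist_of_fun_def by blast
    also have "\<dots> = (LINT x|lebesgue. h' x * \<phi> t x)"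
    proof (intro integral_cong_AE borel_measurable_times h measurable_completion)
      show "AE x in lebesgue. h x * \<phi> t x = h' x * \<phi> t x"
        using hh' by eventually_elim simp
    qed simp_all
    also have "\<dots> = (LINT x|lborel. h' x * \<phi> t x)"
      by (intro integral_completion) simp
    finally show "(LINT x|lborel. g x * iexp (t * x)) = 0"
      unfolding g_eq using hint fint by simp
  qed
  then have "AE x in lborel. h' x = fourier f x"
    by eventually_elim (simp add: g_def)
  then have "AE x in lebesgue. h' x = fourier f x"
    by (rule AE_completion)
  with hh' show ?thesis by eventually_elim simp
qed

section \<open>Variable Lebesgue spaces\<close>

text \<open>Above \<mu> the ratio t / \<mu> exceeds 1 and only grows when raised to the power q. As
  \<mu> <= 1, the constant is uniform over all q <= r. With \<mu> free to be optimised, this stands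
  in for Hoelder's inequality with a variable exponent.\<close>

lemma le_add_powr_exponent:
  fixes t \<mu> q r :: real
  assumes "0 < \<mu>" "\<mu> \<le> 1" "1 \<le> q" "q \<le> r" "0 \<le> t"
  shows "t \<le> \<mu> + \<mu> powr (1 - r) * t powr q"
proof (cases "t \<le> \<mu>")
  case True
  then show ?thesis by (simp add: add_increasing2)
next
  case False
  have "t = \<mu> * (t / \<mu>) powr 1" using assms False by simp
  also have "\<dots> \<le> \<mu> * (t / \<mu>) powr q"
    using assms False by (intro mult_left_mono powr_mono) auto
  also have "\<dots> = \<mu> powr (1 - q) * t powr q"
    using assms by (simp add: powr_divide powr_diff)
  also have "\<dots> \<le> \<mu> powr (1 - r) * t powr q"
    using assms by (intro mult_right_mono powr_mono') auto
  finally show ?thesis using assms by linarith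
qed

lemma sets_exponent_infinite:
  assumes "p \<in> exponents"
  shows "{x. p x = \<infinity>} \<in> sets lebesgue" "{x. p x \<noteq> \<infinity>} \<in> sets lebesgue"
proof -
  have [measurable]: "p \<in> borel_measurable lebesgue" using assms by (simp add: exponents_def)
  have "{x \<in> space lebesgue. p x = \<infinity>} \<in> sets lebesgue" "{x \<in> space lebesgue. p x \<noteq> \<infinity>} \<in> sets lebesgue"
    by measurable
  then show "{x. p x = \<infinity>} \<in> sets lebesgue" "{x. p x \<noteq> \<infinity>} \<in> sets lebesgue" by simp_all
qed

lemma esssup_exponent_infinite_le:
  assumes "p \<in> exponents" "f \<in> borel_measurable lebesgue"
    and "AE x in lebesgue. p x = \<infinity> \<longrightarrow> ennreal (norm (f x)) \<le> c"
  shows "esssup (restrict_space lebesgue {x. p x = \<infinity>}) (\<lambda>x. ennreal (norm (f x))) \<le> c"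
  using assms(2,3) sets_exponent_infinite(1)[OF assms(1)]
  by (intro esssup_I measurable_restrict_space1) (simp_all add: AE_restrict_space_iff)

lemma AE_le_esssup_exponent_infinite:
  assumes "p \<in> exponents"
  shows "AE x in lebesgue. p x = \<infinity> \<longrightarrow>
    ennreal (norm (f x)) \<le> esssup (restrict_space lebesgue {x. p x = \<infinity>}) (\<lambda>x. ennreal (norm (f x)))"
  using esssup_AE[where M = "restrict_space lebesgue {x. p x = \<infinity>}" and f = "\<lambda>x. ennreal (norm (f x))"]
    sets_exponent_infinite(1)[OF assms] by (simp add: AE_restrict_space_iff)

lemma real_of_exponent_ge_1:
  assumes "p \<in> exponents" "p x \<noteq> \<infinity>"
  shows "1 \<le> real_of_ereal (p x)"
proof -
  have "1 \<le> p x" using assms(1) by (simp add: exponents_def)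
  then show ?thesis using assms(2) by (cases "p x") auto
qed

lemma borel_measurable_powr_exponent:
  assumes "p \<in> exponents" "f \<in> borel_measurable lebesgue"
  shows "(\<lambda>x. ennreal (norm (f x) powr real_of_ereal (p x))) \<in> borel_measurable lebesgue"
proof -
  have [measurable]: "p \<in> borel_measurable lebesgue" using assms by (simp add: exponents_def)
  note [measurable] = assms(2)
  show ?thesis by measurable
qed

text \<open>Exponents are at least 1, so dividing by \<open>m >= 1\<close> gains at least the factor
  \<open>1 / m\<close> in the integral, and exactly this factor in the essential supremum.\<close>

lemma modular_scale_le:
  assumes p: "p \<in> exponents" and f: "f \<in> borel_measurable lebesgue" and m: "1 \<le> m"
  shows "modular p (\<lambda>x. f x /\<^sub>R m) \<le> ennreal (1 / m) * modular p f"
proof -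
  have "norm (f x /\<^sub>R m) powr real_of_ereal (p x) \<le> (1 / m) * norm (f x) powr real_of_ereal (p x)"
    if "p x \<noteq> \<infinity>" for x
  proof -
    have "norm (f x /\<^sub>R m) powr real_of_ereal (p x) = (1 / m) powr real_of_ereal (p x) * norm (f x) powr real_of_ereal (p x)"
      using m by (simp add: powr_mult[symmetric] divide_inverse)
    also have "(1 / m) powr real_of_ereal (p x) \<le> (1 / m) powr 1"
      using m real_of_exponent_ge_1[OF p that] by (intro powr_mono') auto
    finally show ?thesis using m by (simp add: mult_right_mono)
  qed
  then have "ennreal (norm (f x /\<^sub>R m) powr real_of_ereal (p x)) * indicator {x. p x \<noteq> \<infinity>} x
     \<le> ennreal (1 / m) * (ennreal (norm (f x) powr real_of_ereal (p x)) * indicator {x. p x \<noteq> \<infinity>} x)" for x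
    using m by (auto simp: ennreal_mult'[symmetric] intro!: ennreal_leI split: split_indicator)
  then have "(\<integral>\<^sup>+x\<in>{x. p x \<noteq> \<infinity>}. ennreal (norm (f x /\<^sub>R m) powr real_of_ereal (p x)) \<partial>lebesgue)
      \<le> (\<integral>\<^sup>+x. ennreal (1 / m) * (ennreal (norm (f x) powr real_of_ereal (p x)) * indicator {x. p x \<noteq> \<infinity>} x) \<partial>lebesgue)"
    by (intro nn_integral_mono)
  also have "\<dots> = ennreal (1 / m) * (\<integral>\<^sup>+x\<in>{x. p x \<noteq> \<infinity>}. ennreal (norm (f x) powr real_of_ereal (p x)) \<partial>lebesgue)"
    using borel_measurable_powr_exponent[OF p f] sets_exponent_infinite(2)[OF p]
    by (intro nn_integral_cmult borel_measurable_times_ennreal borel_measurable_indicator)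
  finally have 1: "(\<integral>\<^sup>+x\<in>{x. p x \<noteq> \<infinity>}. ennreal (norm (f x /\<^sub>R m) powr real_of_ereal (p x)) \<partial>lebesgue) \<le> \<dots>" .
  have "esssup (restrict_space lebesgue {x. p x = \<infinity>}) (\<lambda>x. ennreal (norm (f x /\<^sub>R m)))
     \<le> ennreal (1 / m) * esssup (restrict_space lebesgue {x. p x = \<infinity>}) (\<lambda>x. ennreal (norm (f x)))"
    using AE_le_esssup_exponent_infinite[OF p, of f]
  proof (intro esssup_exponent_infinite_le[OF p], goal_cases)
    case 1
    then show ?case using f by simp
  next
    case 2
    then show ?case
    proof eventually_elim
      case (elim x)
      have "ennreal (norm (f x /\<^sub>R m)) = ennreal (1 / m) * ennreal (norm (f x))"
        using m by (simp add: ennreal_mult'[symmetric] divide_inverse)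
      then show ?case using elim by (auto intro: mult_left_mono)
    qed
  qed
  with 1 show ?thesis
    unfolding modular_def distrib_left by (rule add_mono)
qed

text \<open>The infimum yields such an \<open>l\<close> once the set of admissible scales is known
  to be nonempty: if the modular at scale \<open>l\<close> has the finite value \<open>a\<close>,
  then at scale \<open>l * (a + 1)\<close> it is at most 1.\<close>

lemma Lvar_normD:
  assumes p: "p \<in> exponents" and h: "h \<in> Lvar p" and L: "Lvar_norm p h < L"
  obtains l where "0 < l" "l < L" "modular p (\<lambda>x. h x /\<^sub>R l) \<le> 1"
proof -
  have hm: "h \<in> borel_measurable lebesgue" using h by (simp add: Lvar_def)
  obtain l where l: "l > 0" "modular p (\<lambda>x. h x /\<^sub>R l) < \<infinity>"
    using h by (auto simp: Lvar_def)
  define a where "a = enn2real (modular p (\<lambda>x. h x /\<^sub>R l))"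
  have a: "modular p (\<lambda>x. h x /\<^sub>R l) = ennreal a" "0 \<le> a"
    using l by (simp_all add: a_def)
  have "modular p (\<lambda>x. (h x /\<^sub>R l) /\<^sub>R (a + 1)) \<le> ennreal (1 / (a + 1)) * ennreal a"
    using modular_scale_le[OF p, of "\<lambda>x. h x /\<^sub>R l" "a + 1"] a hm by simp
  also have "\<dots> = ennreal (a / (a + 1))"
    using a by (simp add: ennreal_mult'[symmetric])
  also have "\<dots> \<le> 1"
    using a by simp
  finally have "modular p (\<lambda>x. h x /\<^sub>R (l * (a + 1))) \<le> 1"
    by (simp add: mult.commute)
  then have "{l. l > 0 \<and> modular p (\<lambda>x. h x /\<^sub>R l) \<le> 1} \<noteq> {}"
    using l a by (auto intro!: exI[of _ "l * (a + 1)"])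
  from cInf_lessD[OF this] show thesis
    using L that unfolding Lvar_norm_def by blast
qed

lemma Lvar_norm_le:
  assumes "0 < l" "modular p (\<lambda>x. f x /\<^sub>R l) \<le> 1"
  shows "Lvar_norm p f \<le> l"
  unfolding Lvar_norm_def using assms by (intro cInf_lower bdd_belowI[of _ 0]) auto

text \<open>Where the exponent is finite, \<open>f\<close> divided by \<open>l\<close> is at most 1
  / l <= 1 on \<open>A\<close>, so the smallest exponent \<open>r\<close> gives the largest power;
  the essential supremum contributes at most \<open>1 / l\<close>.\<close>

lemma modular_bounded_le:
  assumes p: "p \<in> exponents" and f: "f \<in> borel_measurable lebesgue"
    and f1: "\<And>x. norm (f x) \<le> indicator A x"
    and A: "A \<in> sets lebesgue" "emeasure lebesgue A \<le> ennreal M" "0 \<le> M"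
    and r: "\<And>x. x \<in> A \<Longrightarrow> ereal r \<le> p x" and l: "1 \<le> l"
  shows "modular p (\<lambda>x. f x /\<^sub>R l) \<le> ennreal (M * l powr (- r) + 1 / l)"
proof -
  have "ennreal (norm (f x /\<^sub>R l) powr real_of_ereal (p x)) * indicator {x. p x \<noteq> \<infinity>} x
      \<le> ennreal (l powr (- r)) * indicator A x" for x
  proof (cases "x \<in> A \<and> p x \<noteq> \<infinity>")
    case True
    have "r \<le> real_of_ereal (p x)"
      using r[of x] True by (cases "p x") auto
    have "norm (f x /\<^sub>R l) \<le> 1 / l"
      using f1[of x] True l by (simp add: divide_inverse mult_left_le)
    then have "norm (f x /\<^sub>R l) powr real_of_ereal (p x) \<le> (1 / l) powr real_of_ereal (p x)"
      using real_of_exponent_ge_1[OF p] True by (intro powr_mono2) force+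
    also have "\<dots> \<le> (1 / l) powr r"
      using l \<open>r \<le> _\<close> by (intro powr_mono') auto
    also have "\<dots> = l powr (- r)"
      using l by (simp add: powr_minus_divide powr_divide)
    finally show ?thesis using True by (simp add: ennreal_leI)
  next
    case False
    then show ?thesis using f1[of x] by (auto split: split_indicator)
  qed
  then have "(\<integral>\<^sup>+x\<in>{x. p x \<noteq> \<infinity>}. ennreal (norm (f x /\<^sub>R l) powr real_of_ereal (p x)) \<partial>lebesgue)
      \<le> (\<integral>\<^sup>+x. ennreal (l powr (- r)) * indicator A x \<partial>lebesgue)"
    by (intro nn_integral_mono)
  also have "\<dots> = ennreal (l powr (- r)) * emeasure lebesgue A"
    using A by (rule_tac nn_integral_cmult_indicator)
  also have "\<dots> \<le> ennreal (l powr (- r)) * ennreal M"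
    by (intro mult_left_mono A) simp
  also have "\<dots> = ennreal (M * l powr (- r))"
    using A by (simp add: ennreal_mult'[symmetric] mult.commute)
  finally have 1: "(\<integral>\<^sup>+x\<in>{x. p x \<noteq> \<infinity>}. ennreal (norm (f x /\<^sub>R l) powr real_of_ereal (p x)) \<partial>lebesgue) \<le> \<dots>" .
  have "norm (f x /\<^sub>R l) \<le> 1 / l" for x
    using f1[of x] l by (simp add: divide_inverse mult_left_le split: split_indicator_asm)
  then have "esssup (restrict_space lebesgue {x. p x = \<infinity>}) (\<lambda>x. ennreal (norm (f x /\<^sub>R l))) \<le> ennreal (1 / l)"
    using f by (intro esssup_exponent_infinite_le[OF p]) (simp_all add: ennreal_leI)
  with 1 have "modular p (\<lambda>x. f x /\<^sub>R l) \<le> ennreal (M * l powr (- r)) + ennreal (1 / l)"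
    unfolding modular_def by (rule add_mono)
  then show ?thesis
    using A l by (simp add: ennreal_plus[symmetric] del: ennreal_plus)
qed

text \<open>For r > 0 and large M the condition \<open>le\<close> holds for some \<open>l\<close> of
  order \<open>M powr (1 / r)\<close>, which is where the growth rate of the norm comes
  from.\<close>

lemma bounded_support_Lvar:
  assumes "p \<in> exponents" "f \<in> borel_measurable lebesgue"
    and "\<And>x. norm (f x) \<le> indicator A x"
    and "A \<in> sets lebesgue" "emeasure lebesgue A \<le> ennreal M" "0 \<le> M"
    and "\<And>x. x \<in> A \<Longrightarrow> ereal r \<le> p x" and "1 \<le> l" and le: "M * l powr (- r) + 1 / l \<le> 1"
  shows "f \<in> Lvar p" "Lvar_norm p f \<le> l"
proof -
  have *: "modular p (\<lambda>x. f x /\<^sub>R l) \<le> 1"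
    using modular_bounded_le[OF assms(1-8)] le by (meson ennreal_le_1 order_trans)
  moreover have "1 < (\<infinity> :: ennreal)" by simp
  ultimately have "modular p (\<lambda>x. f x /\<^sub>R l) < \<infinity>" by (rule order.strict_trans1)
  moreover have "0 < l" using assms(8) by simp
  ultimately show "f \<in> Lvar p" unfolding Lvar_def using assms(2) by blast
  show "Lvar_norm p f \<le> l" using * assms(8) by (intro Lvar_norm_le) auto
qed

lemma modular_le_1_AE:
  assumes p: "p \<in> exponents" and "modular p h \<le> 1"
  shows "AE x in lebesgue. p x = \<infinity> \<longrightarrow> norm (h x) \<le> 1"
proof -
  have "esssup (restrict_space lebesgue {x. p x = \<infinity>}) (\<lambda>x. ennreal (norm (h x))) \<le> modular p h"
    unfolding modular_def by simp
  also note assms(2)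
  finally have le: "esssup (restrict_space lebesgue {x. p x = \<infinity>}) (\<lambda>x. ennreal (norm (h x))) \<le> 1" .
  show ?thesis
    using AE_le_esssup_exponent_infinite[OF p, of h]
  proof eventually_elim
    case (elim x)
    show ?case
      using order_trans[OF _ le] elim by (auto simp flip: ennreal_le_1)
  qed
qed

text \<open>The weight \<open>w\<close> is an indicator in the main argument and a Gaussian when the lemma is used for
  integrability.\<close>

lemma nn_integral_modular_le:
  assumes p: "p \<in> exponents" and h: "h \<in> borel_measurable lebesgue" and mod: "modular p h \<le> 1"
    and w: "w \<in> borel_measurable lebesgue" "\<And>x. 0 \<le> w x" "\<And>x. w x \<le> 1"
    and \<mu>: "0 \<le> \<mu>" "0 \<le> \<kappa>"
    and inf: "\<And>x. w x \<noteq> 0 \<Longrightarrow> p x = \<infinity> \<Longrightarrow> 1 \<le> \<mu>"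
    and fin: "\<And>x t. w x \<noteq> 0 \<Longrightarrow> p x \<noteq> \<infinity> \<Longrightarrow> 0 \<le> t \<Longrightarrow> t \<le> \<mu> + \<kappa> * t powr real_of_ereal (p x)"
  shows "(\<integral>\<^sup>+x. ennreal (norm (h x) * w x) \<partial>lebesgue) \<le> ennreal \<mu> * (\<integral>\<^sup>+x. ennreal (w x) \<partial>lebesgue) + ennreal \<kappa>"
proof -
  define m where "m = (\<lambda>x. ennreal (norm (h x) powr real_of_ereal (p x)) * indicator {x. p x \<noteq> \<infinity>} x)"
  have [measurable]: "m \<in> borel_measurable lebesgue"
    unfolding m_def using borel_measurable_powr_exponent[OF p h] sets_exponent_infinite(2)[OF p]
    by (intro borel_measurable_times_ennreal borel_measurable_indicator)
  note [measurable] = w(1)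
  have "AE x in lebesgue. ennreal (norm (h x) * w x) \<le> ennreal \<mu> * ennreal (w x) + ennreal \<kappa> * m x"
    using modular_le_1_AE[OF p mod]
  proof eventually_elim
    case (elim x)
    consider "w x = 0" | "w x \<noteq> 0" "p x = \<infinity>" | "w x \<noteq> 0" "p x \<noteq> \<infinity>" by blast
    then show ?case
    proof cases
      case 1
      then show ?thesis by simp
    next
      case 2
      then have "norm (h x) * w x \<le> \<mu> * w x"
        using elim inf[of x] w(2)[of x] by (intro mult_right_mono) auto
      then show ?thesis
        using \<mu> w(2)[of x] by (auto simp: ennreal_mult'[symmetric] intro!: add_increasing2 ennreal_leI)
    next
      case 3
      define T where "T = norm (h x) powr real_of_ereal (p x)"
      have "norm (h x) * w x \<le> (\<mu> + \<kappa> * T) * w x"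
        using fin[of x "norm (h x)"] 3 w(2)[of x] unfolding T_def by (intro mult_right_mono) auto
      \<comment> \<open>The weight stays next to \<mu>, so that its integral enters there; next to
        \<open>T\<close>, whose integral the modular controls, it is bounded by 1.\<close>
      also have "\<dots> \<le> \<mu> * w x + \<kappa> * T"
        using \<mu> w(3)[of x] by (simp add: distrib_right mult_left_le T_def)
      finally have "ennreal (norm (h x) * w x) \<le> ennreal (\<mu> * w x + \<kappa> * T)"
        by (rule ennreal_leI)
      also have "\<dots> = ennreal \<mu> * ennreal (w x) + ennreal \<kappa> * ennreal T"
        using \<mu> w(2)[of x] by (simp add: ennreal_mult' T_def)
      also have "ennreal T = m x"
        using 3 by (simp add: T_def m_def)
      finally show ?thesis .
    qed
  qed
  then have "(\<integral>\<^sup>+x. ennreal (norm (h x) * w x) \<partial>lebesgue) \<le> (\<integral>\<^sup>+x. ennreal \<mu> * ennreal (w x) + ennreal \<kappa> * m x \<partial>lebesgue)"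
    by (rule nn_integral_mono_AE)
  also have "\<dots> = ennreal \<mu> * (\<integral>\<^sup>+x. ennreal (w x) \<partial>lebesgue) + ennreal \<kappa> * (\<integral>\<^sup>+x. m x \<partial>lebesgue)"
    by (simp add: nn_integral_add nn_integral_cmult)
  also have "(\<integral>\<^sup>+x. m x \<partial>lebesgue) \<le> modular p h"
    unfolding modular_def m_def by simp
  also note mod
  finally show ?thesis by (simp add: mult_left_mono add_left_mono)
qed

section \<open>Sums of signed indicators\<close>

lemma integrable_indicator_Icc:
  assumes "A \<in> sets borel" "A \<subseteq> {a..b::real}"
  shows "integrable lborel (indicator A :: real \<Rightarrow> real)"
    and "integrable lborel (indicator A :: real \<Rightarrow> complex)"
proof -
  have "emeasure lborel A \<le> emeasure lborel {a..b}"
    using assms by (intro emeasure_mono) auto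
  then have "emeasure lborel A < \<infinity>"
    by (auto simp: emeasure_lborel_Icc_eq intro: le_less_trans split: if_splits)
  then show *: "integrable lborel (indicator A :: real \<Rightarrow> real)"
    using assms by (simp add: integrable_indicator_iff)
  have "(indicator A :: real \<Rightarrow> complex) = (\<lambda>x. complex_of_real (indicator A x))"
    by (auto split: split_indicator)
  then show "integrable lborel (indicator A :: real \<Rightarrow> complex)"
    using * by simp
qed

lemma measure_le_Icc:
  assumes "A \<in> sets borel" "A \<subseteq> {a..a + \<delta>::real}" "0 \<le> \<delta>"
  shows "emeasure lborel A = ennreal (measure lborel A)" "measure lborel A \<le> \<delta>"
proof -
  have le: "emeasure lborel A \<le> emeasure lborel {a..a + \<delta>}"
    using assms by (intro emeasure_mono) auto
  then have le': "emeasure lborel A \<le> ennreal \<delta>"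
    using assms(3) by simp
  then show *: "emeasure lborel A = ennreal (measure lborel A)"
    by (intro emeasure_eq_ennreal_measure) (auto simp: top_unique)
  show "measure lborel A \<le> \<delta>"
    using le' assms(3) unfolding * by simp
qed

lemma norm_fourier_indicator_le:
  assumes "A \<in> sets borel" "A \<subseteq> {a..a + \<delta>}" "0 \<le> \<delta>"
  shows "norm (fourier (indicator A) \<xi>) \<le> \<delta>"
proof -
  have "norm (fourier (indicator A) \<xi>) \<le> (LINT x|lborel. norm (indicator A x :: complex))"
    by (intro norm_fourier_le integrable_indicator_Icc(2)[OF assms(1,2)])
  also have "\<dots> = (LINT x|lborel. indicator A x)"
    by (intro Bochner_Integration.integral_cong) (auto split: split_indicator)
  also have "\<dots> = measure lborel A"
    using assms by simp
  finally show ?thesis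
    using measure_le_Icc(2)[OF assms] by simp
qed

text \<open>The unimodular factor \<open>u\<close> moves the phase origin to the midpoint
  \<open>c\<close>. The phase on \<open>A\<close> is then at most 2 pi (\<delta> / 2) / (3 \<delta>)
  = pi / 3, where the cosine is at least 1/2.\<close>

lemma norm_fourier_indicator_ge:
  assumes A: "A \<in> sets borel" "A \<subseteq> {a..a + \<delta>}" and \<delta>: "0 < \<delta>" and \<xi>: "\<bar>\<xi>\<bar> \<le> 1 / (3 * \<delta>)"
  shows "measure lborel A / 2 \<le> norm (fourier (indicator A) \<xi>)"
proof -
  define c where "c = a + \<delta> / 2"
  define u where "u = fourier_kernel c (- \<xi>)"
  note int = integrable_indicator_Icc(2)[OF A]
  have Re: "Re (u * fourier_kernel x \<xi>) = cos (2 * pi * (c - x) * \<xi>)" for x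
  proof -
    have "u * fourier_kernel x \<xi> = exp (\<i> * of_real (2 * pi * (c - x) * \<xi>))"
      unfolding u_def mult_exp_exp by (intro arg_cong[of _ _ exp]) (simp add: algebra_simps)
    then show ?thesis by (simp add: Re_exp)
  qed
  have cos: "1 / 2 \<le> cos (2 * pi * (c - x) * \<xi>)" if "x \<in> A" for x
  proof -
    have "\<bar>c - x\<bar> \<le> \<delta> / 2" using that A unfolding c_def abs_le_iff by (auto simp: field_simps)
    then have "\<bar>c - x\<bar> * \<bar>\<xi>\<bar> \<le> \<delta> / 2 * (1 / (3 * \<delta>))"
      using \<xi> \<delta> by (intro mult_mono) auto
    then have "2 * pi * (\<bar>c - x\<bar> * \<bar>\<xi>\<bar>) \<le> 2 * pi * (1 / 6)"
      using \<delta> by (intro mult_left_mono) auto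
    then have le: "\<bar>2 * pi * (c - x) * \<xi>\<bar> \<le> pi / 3"
      by (simp add: abs_mult mult.assoc)
    have "cos (pi / 3) \<le> cos \<bar>2 * pi * (c - x) * \<xi>\<bar>"
      by (intro cos_monotone_0_pi_le le) auto
    then show ?thesis by (simp add: cos_60)
  qed
  have ints: "integrable lborel (\<lambda>x. u * (indicator A x * fourier_kernel x \<xi>))"
    by (intro integrable_mult_right integrable_fourier_kernel int)
  have "measure lborel A / 2 = (LINT x|lborel. indicator A x * (1 / 2))"
    using A by simp
  also have "\<dots> \<le> (LINT x|lborel. Re (u * (indicator A x * fourier_kernel x \<xi>)))"
  proof (rule integral_mono)
    show "integrable lborel (\<lambda>x. indicator A x * (1 / 2 :: real))"
      using integrable_indicator_Icc(1)[OF A] by simp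
    show "integrable lborel (\<lambda>x. Re (u * (indicator A x * fourier_kernel x \<xi>)))"
      by (intro integrable_Re ints)
    show "indicator A x * (1 / 2) \<le> Re (u * (indicator A x * fourier_kernel x \<xi>))" for x
      using cos[of x] Re[of x] by (cases "x \<in> A") simp_all
  qed
  also have "\<dots> = Re (LINT x|lborel. u * (indicator A x * fourier_kernel x \<xi>))"
    by (intro integral_Re ints)
  also have "\<dots> = Re (u * fourier (indicator A) \<xi>)"
    by (simp add: fourier_lborel[OF int])
  also have "\<dots> \<le> norm (u * fourier (indicator A) \<xi>)"
    by (rule complex_Re_le_cmod)
  also have "\<dots> = norm (fourier (indicator A) \<xi>)"
    unfolding norm_mult u_def norm_fourier_kernel by simp
  finally show ?thesis .
qed

section \<open>Borel pieces of long intervals\<close>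

text \<open>Without two points at distance \<delta>, the interval lies within \<delta> of any of its
  points and has measure at most 2 \<delta>. Endpoints and boundedness of \<open>I\<close> do not
  matter for this argument.\<close>

lemma interval_contains_Icc:
  fixes I :: "real set"
  assumes I: "is_interval I" and \<delta>: "0 < \<delta>" and large: "ennreal (4 * \<delta>) \<le> emeasure lebesgue I"
  obtains a where "{a..a + \<delta>} \<subseteq> I"
proof -
  have "\<exists>x\<in>I. \<exists>y\<in>I. x + \<delta> \<le> y"
  proof (rule ccontr)
    assume small: "\<not> ?thesis"
    have "I \<noteq> {}" using large \<delta> by (auto simp: ennreal_eq_0_iff)
    then obtain x where "x \<in> I" by blast
    then have "I \<subseteq> {x - \<delta>..x + \<delta>}" using small by (fastforce simp: not_le)
    then have "emeasure lebesgue I \<le> emeasure lebesgue {x - \<delta>..x + \<delta>}"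
      by (intro emeasure_mono) auto
    also have "\<dots> = ennreal (2 * \<delta>)" using \<delta> by simp
    finally have "ennreal (4 * \<delta>) \<le> ennreal (2 * \<delta>)" using large by (rule order_trans[rotated])
    then show False using \<delta> by simp
  qed
  then obtain x y where xy: "x \<in> I" "y \<in> I" "x + \<delta> \<le> y" by blast
  have "{x..x + \<delta>} \<subseteq> I"
  proof
    fix z assume "z \<in> {x..x + \<delta>}"
    then show "z \<in> I" using xy mem_is_interval_1_I[OF I xy(1,2), of z] by auto
  qed
  then show thesis by (rule that)
qed

text \<open>A closed subinterval of length \<delta> loses at most \<delta> / 2 outside
  \<open>E\<close>. What remains is Lebesgue measurable; its \<open>main_part\<close> is a Borel
  subset of the same measure.\<close>

lemma Borel_part_of_interval:
  fixes I :: "real set"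
  assumes I: "is_interval I" and \<delta>: "0 < \<delta>" and large: "ennreal (4 * \<delta>) \<le> emeasure lebesgue I"
    and E: "E \<in> sets lebesgue" and Im: "I \<in> sets lebesgue"
    and small: "emeasure lebesgue (I - E) \<le> ennreal (\<delta> / 2)"
  shows "\<exists>A a. A \<in> sets borel \<and> A \<subseteq> {a..a + \<delta>} \<and> A \<subseteq> I \<inter> E \<and> \<delta> / 2 \<le> measure lborel A"
proof -
  obtain a where a: "{a..a + \<delta>} \<subseteq> I"
    using interval_contains_Icc[OF I \<delta> large] .
  define K where "K = {a..a + \<delta>}"
  have [measurable]: "K \<in> sets lebesgue" unfolding K_def by simp
  define A where "A = main_part lborel (K \<inter> E)"
  have KE: "K \<inter> E \<in> sets (completion lborel)" using E by simp
  have A: "A \<in> sets borel" "A \<subseteq> K \<inter> E"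
    using main_part_sets[OF KE] main_part_null_part_Un[OF KE] unfolding A_def by auto
  have "ennreal \<delta> = emeasure lebesgue K"
    unfolding K_def using \<delta> by simp
  also have "\<dots> = emeasure lebesgue ((K \<inter> E) \<union> (K - E))"
    by (simp add: Int_Diff_Un)
  also have "\<dots> \<le> emeasure lebesgue (K \<inter> E) + emeasure lebesgue (K - E)"
    using E by (intro emeasure_subadditive) auto
  also have "emeasure lebesgue (K - E) \<le> emeasure lebesgue (I - E)"
    using a E Im unfolding K_def by (intro emeasure_mono) auto
  also note small
  also have "emeasure lebesgue (K \<inter> E) = ennreal (measure lborel A)"
    using measure_le_Icc(1)[of A a \<delta>] A \<delta> emeasure_completion[OF KE] unfolding A_def K_def by auto
  finally have "ennreal \<delta> \<le> ennreal (measure lborel A + \<delta> / 2)"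
    using \<delta> by (simp add: add_left_mono)
  then have "\<delta> / 2 \<le> measure lborel A"
    using \<delta> by (simp add: ennreal_le_iff del: ennreal_plus)
  then show ?thesis using A a unfolding K_def by blast
qed

lemma not_tendsto_0_ennreal:
  fixes f :: "nat \<Rightarrow> ennreal"
  assumes "\<not> f \<longlonglongrightarrow> 0"
  obtains e where "0 < e" "\<exists>\<^sub>F j in sequentially. ennreal e \<le> f j"
proof -
  obtain u where u: "0 < u" "\<exists>\<^sub>F j in sequentially. u \<le> f j"
    using assms unfolding order_tendsto_iff frequently_def by (auto simp: not_le)
  \<comment> \<open>The bound \<open>u\<close> may be infinite, so it is truncated to obtain a real
    \<open>e\<close>.\<close>
  have "0 < min u 1" "min u 1 < top"
    using u(1) by (auto simp: min_less_iff_disj)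
  then obtain e where e: "min u 1 = ennreal e" "0 < e"
    by (cases "min u 1" rule: ennreal_cases) auto
  from u(2) have "\<exists>\<^sub>F j in sequentially. ennreal e \<le> f j"
    by (rule frequently_elim1) (metis e(1) min.cobounded1 order_trans)
  with e(2) show thesis by (rule that)
qed

text \<open>The measures are the terms of a convergent series.\<close>

lemma emeasure_disjoint_family_small:
  assumes "disjoint_family B" "range B \<subseteq> sets M" "emeasure M (\<Union>j. B j) < \<infinity>" "0 < e"
  shows "\<forall>\<^sub>F j in sequentially. emeasure M (B j) \<le> ennreal e"
proof -
  have fin: "emeasure M (B j) = ennreal (measure M (B j))" for j
  proof (rule emeasure_eq_ennreal_measure)
    have "emeasure M (B j) \<le> emeasure M (\<Union>j. B j)"
      using assms(2) by (intro emeasure_mono) auto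
    then show "emeasure M (B j) \<noteq> top"
      using assms(3) by (auto simp: top_unique)
  qed
  have "(\<Sum>j. ennreal (measure M (B j))) \<noteq> top"
    using suminf_emeasure[OF assms(2,1)] assms(3) by (simp add: fin)
  then have "summable (\<lambda>j. measure M (B j))"
    by (intro summable_suminf_not_top) auto
  then have "\<forall>\<^sub>F j in sequentially. measure M (B j) < e"
    using summable_LIMSEQ_zero assms(4) by (intro order_tendstoD(2)) auto
  then show ?thesis
    by eventually_elim (simp add: fin ennreal_leI)
qed

text \<open>Here \<open>f\<close> is a sum of randomly signed indicators of \<open>N\<close> sets of comparable measure, each inside
  an interval of length \<open>\<delta>\<close>: on \<open>[-b, b]\<close> none of their Fourier transforms oscillates, so
  Khintchine's inequality applies there.\<close>

lemma large_fourier_on_interval: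
  fixes I :: "nat \<Rightarrow> real set"
  assumes I: "\<And>j. is_interval (I j)" "disjoint_family I" and E: "E \<in> sets lebesgue"
    and fin: "emeasure lebesgue ((\<Union>j. I j) - E) < \<infinity>"
    and large: "\<not> (\<lambda>j. emeasure lebesgue (I j)) \<longlonglongrightarrow> 0"
  obtains \<delta> b c where "0 < \<delta>" "0 < b" "0 < c"
    and "\<forall>N. \<exists>f A. A \<in> sets borel \<and> A \<subseteq> E \<and> emeasure lborel A \<le> ennreal (real N * \<delta>) \<and>
      integrable lborel f \<and> (\<forall>x. norm (f x :: complex) \<le> indicator A x) \<and>
      ennreal (c * sqrt (real N)) \<le> (\<integral>\<^sup>+x\<in>{-b..b}. ennreal (norm (fourier f x)) \<partial>lborel)"
proof -
  obtain e where e: "0 < e" "\<exists>\<^sub>F j in sequentially. ennreal e \<le> emeasure lebesgue (I j)"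
    using not_tendsto_0_ennreal[OF large] .
  \<comment> \<open>The 4 is the one required for finding a closed subinterval of length \<delta>;
    on [-b, b] the lower bound for transforms of indicators holds.\<close>
  define \<delta> b where "\<delta> = e / 4" and "b = 1 / (3 * \<delta>)"
  have \<delta>: "0 < \<delta>" "e = 4 * \<delta>" and b: "0 < b" using e by (auto simp: \<delta>_def b_def)
  have Im: "I j \<in> sets lebesgue" for j
    using real_interval_borel_measurable[OF I(1)] by simp
  have "(\<Union>j. I j) - E = (\<Union>j. I j - E)" by blast
  then have "\<forall>\<^sub>F j in sequentially. emeasure lebesgue (I j - E) \<le> ennreal (\<delta> / 2)"
    using I(2) fin Im E \<delta> by (intro emeasure_disjoint_family_small) (auto simp: disjoint_family_on_def)
  with e(2) have "\<exists>\<^sub>F j in sequentially. ennreal e \<le> emeasure lebesgue (I j) \<and>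
      emeasure lebesgue (I j - E) \<le> ennreal (\<delta> / 2)"
    by (rule frequently_eventually_frequently)
  then have inf: "infinite {j. ennreal e \<le> emeasure lebesgue (I j) \<and>
      emeasure lebesgue (I j - E) \<le> ennreal (\<delta> / 2)}" (is "infinite ?S")
    by (simp add: frequently_cofinite[symmetric] cofinite_eq_sequentially)
  \<comment> \<open>Passes to the infinitely many long intervals with small remainder; injectivity
    of \<open>r\<close> keeps the chosen pieces disjoint.\<close>
  define r where "r = enumerate ?S"
  have r: "r n \<in> ?S" "inj r" for n
    unfolding r_def using enumerate_in_set[OF inf] inj_enumerate[OF inf] by auto
  have "\<exists>A a. A \<in> sets borel \<and> A \<subseteq> {a..a + \<delta>} \<and> A \<subseteq> I (r n) \<inter> E \<and> \<delta> / 2 \<le> measure lborel A" for n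
    using r(1)[of n] \<delta> I(1) E Im by (intro Borel_part_of_interval) auto
  then obtain A a where A: "\<And>n. A n \<in> sets borel" "\<And>n. A n \<subseteq> {a n..a n + \<delta>}"
      "\<And>n. A n \<subseteq> I (r n) \<inter> E" "\<And>n. \<delta> / 2 \<le> measure lborel (A n)"
    by metis
  have disj: "disjoint_family A"
    unfolding disjoint_family_on_def
  proof (intro ballI impI)
    fix m n :: nat assume "m \<noteq> n"
    then have "r m \<noteq> r n" using r(2) by (auto dest: injD)
    then have "I (r m) \<inter> I (r n) = {}" using I(2) by (auto simp: disjoint_family_on_def)
    then show "A m \<inter> A n = {}" using A(3)[of m] A(3)[of n] by blast
  qed
  note int = integrable_indicator_Icc(2)[OF A(1,2)]
  \<comment> \<open>Division by \<delta> normalises the transforms to lie between 1/4 and 1 in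
    modulus on [-b, b].\<close>
  define h where "h = (\<lambda>n \<xi>. fourier (indicator (A n)) \<xi> / of_real \<delta>)"
  have h_cont: "continuous_on {-b..b} (h n)" for n
    unfolding h_def using \<delta> by (intro continuous_intros continuous_on_fourier int) auto
  have h_low: "1 / 4 \<le> norm (h n \<xi>)" if "\<xi> \<in> {-b..b}" for n \<xi>
  proof -
    have "\<delta> / 2 / 2 \<le> norm (fourier (indicator (A n)) \<xi>)"
      using norm_fourier_indicator_ge[OF A(1,2) \<delta>(1), of \<xi> n] that A(4)[of n]
      unfolding b_def abs_le_iff by auto
    then show ?thesis unfolding h_def using \<delta> by (simp add: norm_divide field_simps)
  qed
  have h_up: "norm (h n \<xi>) \<le> 1" for n \<xi>
    using norm_fourier_indicator_le[OF A(1,2), of n \<xi>] \<delta> unfolding h_def by (simp add: norm_divide)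
  define c where "c = \<delta> * ((2 * b) * (1 / 4) ^ 3 / 2)"
  have "\<exists>f A. A \<in> sets borel \<and> A \<subseteq> E \<and> emeasure lborel A \<le> ennreal (real N * \<delta>) \<and>
      integrable lborel f \<and> (\<forall>x. norm (f x :: complex) \<le> indicator A x) \<and>
      ennreal (c * sqrt (real N)) \<le> (\<integral>\<^sup>+x\<in>{-b..b}. ennreal (norm (fourier f x)) \<partial>lborel)" for N
  proof -
    obtain s :: "nat \<Rightarrow> real" where s: "\<And>j. s j \<in> {-1, 1}"
      and ge: "(b - - b) * (1 / 4) ^ 3 / 2 * sqrt (real N)
        \<le> integral {-b..b} (\<lambda>x. norm (\<Sum>j<N. s j *\<^sub>R h j x))"
      using signs_large_L1[of "1 / 4" "- b" b h N] h_cont h_low h_up b by auto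
    define f where "f = (\<lambda>x. \<Sum>n<N. s n *\<^sub>R (indicator (A n) x :: complex))"
    define U where "U = (\<Union>n<N. A n)"
    have U: "U \<in> sets borel" "U \<subseteq> E"
      unfolding U_def using A(1,3) by auto
    have "emeasure lborel U \<le> (\<Sum>n<N. emeasure lborel (A n))"
      unfolding U_def using A(1) by (intro emeasure_subadditive_finite) auto
    also have "\<dots> \<le> (\<Sum>n<N. ennreal \<delta>)"
      using measure_le_Icc[OF A(1,2)] \<delta> by (intro sum_mono) (simp add: ennreal_leI)
    also have "\<dots> = ennreal (real N * \<delta>)"
      using \<delta> by (simp add: ennreal_mult' ennreal_of_nat_eq_real_of_nat)
    finally have emU: "emeasure lborel U \<le> ennreal (real N * \<delta>)" .
    have fint: "integrable lborel f"
      unfolding f_def by (intro Bochner_Integration.integrable_sum integrable_scaleR_right int)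
    have f1: "norm (f x) \<le> indicator U x" for x
    proof (cases "x \<in> U")
      case True
      then obtain k where k: "k < N" "x \<in> A k" by (auto simp: U_def)
      have "x \<notin> A n" if "n \<noteq> k" for n
        using disj k(2) that by (auto simp: disjoint_family_on_def)
      \<comment> \<open>Only one of the disjoint pieces contains \<open>x\<close>, so the terms
        cannot accumulate.\<close>
      then have "f x = (\<Sum>n\<in>{k}. s n *\<^sub>R indicator (A n) x)"
        unfolding f_def using k by (intro sum.mono_neutral_right) auto
      then show ?thesis using s[of k] k True by auto
    next
      case False
      then show ?thesis by (simp add: f_def U_def)
    qed
    have four: "fourier f x = of_real \<delta> * (\<Sum>j<N. s j *\<^sub>R h j x)" for x
      unfolding f_def fourier_sum[OF int] h_def using \<delta> by (simp add: sum_distrib_left)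
    have "((\<lambda>x. norm (fourier f x)) has_integral integral {-b..b} (\<lambda>x. norm (fourier f x))) {-b..b}"
      by (intro integrable_integral integrable_continuous_interval continuous_intros continuous_on_fourier fint)
    then have eq: "(\<integral>\<^sup>+x\<in>{-b..b}. ennreal (norm (fourier f x)) \<partial>lborel)
        = ennreal (integral {-b..b} (\<lambda>x. norm (fourier f x)))"
      by (intro nn_integral_has_integral_lebesgue') auto
    have "c * sqrt (real N) \<le> \<delta> * integral {-b..b} (\<lambda>x. norm (\<Sum>j<N. s j *\<^sub>R h j x))"
      using mult_left_mono[OF ge, of \<delta>] \<delta> by (simp add: c_def mult.assoc)
    also have "\<dots> = integral {-b..b} (\<lambda>x. norm (fourier f x))"
      unfolding four norm_mult using \<delta> by simp
    finally have "ennreal (c * sqrt (real N)) \<le> (\<integral>\<^sup>+x\<in>{-b..b}. ennreal (norm (fourier f x)) \<partial>lborel)"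
      unfolding eq by (rule ennreal_leI)
    then show ?thesis using U emU fint f1 by blast
  qed
  moreover have "0 < c" unfolding c_def using \<delta> b by simp
  ultimately show thesis using that[of \<delta> b c] \<delta> b by blast
qed

text \<open>The source of both contradictions, with \<theta> = 1 / r for r > 2 in (i) and \<theta> =
  1 - 1 / r for r < 2 in (ii).\<close>

lemma sqrt_not_le_powr:
  assumes "\<theta> < 1 / 2" "0 < c"
  shows "\<exists>N::nat. 1 \<le> N \<and> K * real N powr \<theta> < c * sqrt (real N)"
proof -
  have "((\<lambda>x::real. x powr (\<theta> - 1 / 2)) \<longlongrightarrow> 0) at_top"
    using assms by (intro tendsto_neg_powr) (auto intro: filterlim_ident)
  then have "(\<lambda>N. K * real N powr (\<theta> - 1 / 2)) \<longlonglongrightarrow> K * 0"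
    by (intro tendsto_mult tendsto_const filterlim_compose[OF _ filterlim_real_sequentially])
  then have "\<forall>\<^sub>F N in sequentially. K * real N powr (\<theta> - 1 / 2) < c"
    using assms by (intro order_tendstoD(2)[of _ "K * 0"]) auto
  then have "\<forall>\<^sub>F N in sequentially. 1 \<le> N \<and> K * real N powr (\<theta> - 1 / 2) < c"
    using eventually_ge_at_top[of "1 :: nat"] by eventually_elim simp
  then obtain N :: nat where N: "1 \<le> N" "K * real N powr (\<theta> - 1 / 2) < c"
    using eventually_happens trivial_limit_sequentially by blast
  have "K * real N powr \<theta> = K * real N powr (\<theta> - 1 / 2) * sqrt (real N)"
    using N(1) by (simp add: powr_half_sqrt[symmetric] powr_add[symmetric])
  also have "\<dots> < c * sqrt (real N)"
    using N by (intro mult_strict_right_mono) auto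
  finally show ?thesis using N(1) by blast
qed

section \<open>Bounded Fourier transforms\<close>

text \<open>Replaces the representing function by the Fourier integral itself. The Gaussian
  integrability needed to identify the two follows from the modular bound.\<close>

lemma fourier_bounded_on_integrable:
  assumes q: "q \<in> exponents" and C: "0 < C"
    and bd: "\<forall>f\<in>Lvar p. \<exists>h\<in>Lvar q. represents h (fourier_dist (dist_of_fun f)) \<and> Lvar_norm q h \<le> C * Lvar_norm p f"
    and f: "integrable lborel f" "f \<in> Lvar p" "Lvar_norm p f \<le> L" "0 < L"
  obtains h l where "h \<in> borel_measurable lebesgue" "0 < l" "l \<le> 2 * C * L"
    "modular q h \<le> 1" "AE x in lebesgue. fourier f x = l *\<^sub>R h x"
proof -
  obtain g where g: "g \<in> Lvar q" "represents g (fourier_dist (dist_of_fun f))"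
      "Lvar_norm q g \<le> C * Lvar_norm p f"
    using bd f(2) by blast
  have gm: "g \<in> borel_measurable lebesgue" using g(1) by (simp add: Lvar_def)
  have "C * Lvar_norm p f \<le> C * L" using f(3) C by simp
  \<comment> \<open>The factor 2 provides the strict inequality from which a scale below the bound
    is extracted.\<close>
  moreover have "C * L < 2 * C * L" using C f(4) by simp
  ultimately have "Lvar_norm q g < 2 * C * L" using g(3) by linarith
  then obtain l where l: "0 < l" "l < 2 * C * L" "modular q (\<lambda>x. g x /\<^sub>R l) \<le> 1"
    using Lvar_normD[OF q g(1)] by blast
  define h where "h = (\<lambda>x. g x /\<^sub>R l)"
  have hm: "h \<in> borel_measurable lebesgue" using gm by (simp add: h_def)
  have gh: "g x = l *\<^sub>R h x" for x using l(1) by (simp add: h_def)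
  define w where "w = (\<lambda>x :: real. exp (- x\<^sup>2 / 2))"
  have w: "w \<in> borel_measurable lebesgue" "0 \<le> w x" "w x \<le> 1" for x
    unfolding w_def by (auto intro: measurable_completion)
  \<comment> \<open>With \<mu> = 1 the constant is 1 for every finite exponent, so \<open>q\<close>
    may be unbounded.\<close>
  have t: "t \<le> 1 + 1 * t powr real_of_ereal (q x)" if "q x \<noteq> \<infinity>" "0 \<le> t" for x t
    using le_add_powr_exponent[of 1 "real_of_ereal (q x)" "real_of_ereal (q x)" t]
      real_of_exponent_ge_1[OF q that(1)] that(2) by simp
  have "(\<integral>\<^sup>+x. ennreal (norm (h x) * w x) \<partial>lebesgue) \<le> ennreal 1 * (\<integral>\<^sup>+x. ennreal (w x) \<partial>lebesgue) + ennreal 1"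
    using l(3) t by (intro nn_integral_modular_le[OF q hm _ w]) (simp_all add: h_def)
  also have "(\<integral>\<^sup>+x. ennreal (w x) \<partial>lebesgue) = (\<integral>\<^sup>+x. ennreal (w x) \<partial>lborel)"
    by (rule nn_integral_completion)
  also have "\<dots> = ennreal (LINT x|lborel. w x)"
    using integrable_gauss unfolding w_def by (intro nn_integral_eq_integral) auto
  finally have hfin: "(\<integral>\<^sup>+x. ennreal (norm (h x) * w x) \<partial>lebesgue) < \<infinity>"
    by (rule le_less_trans) (simp add: ennreal_add_less_top)
  have "(\<integral>\<^sup>+x. ennreal (norm (g x) * w x) \<partial>lebesgue) = (\<integral>\<^sup>+x. ennreal l * ennreal (norm (h x) * w x) \<partial>lebesgue)"
    unfolding gh using l(1) w(2) by (intro nn_integral_cong) (simp add: ennreal_mult'[symmetric] mult.assoc)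
  also have "\<dots> = ennreal l * (\<integral>\<^sup>+x. ennreal (norm (h x) * w x) \<partial>lebesgue)"
    using hm w(1) by (intro nn_integral_cmult) simp
  also have "\<dots> < \<infinity>"
    using hfin by (simp add: ennreal_mult_less_top)
  finally have "AE x in lebesgue. g x = fourier f x"
    unfolding w_def by (intro represents_fourier_AE[OF f(1) gm _ g(2)])
  then have "AE x in lebesgue. fourier f x = l *\<^sub>R h x"
    by eventually_elim (simp add: gh)
  with hm l show thesis unfolding h_def by (intro that) auto
qed

text \<open>The indicator case of \<open>nn_integral_modular_le\<close>, scaled back from
  \<open>h\<close> to \<open>g\<close>. Both \<mu> and \<kappa> are 1 when the exponent is arbitrary
  on \<open>A\<close>; they are balanced against \<open>M\<close> when it is bounded there.\<close>

lemma nn_integral_set_modular_le: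
  assumes p: "p \<in> exponents" and h: "h \<in> borel_measurable lebesgue" and mod: "modular p h \<le> 1"
    and g: "AE x in lebesgue. g x = l *\<^sub>R h x" and l: "0 < l" "l \<le> L"
    and A: "A \<in> sets borel" "emeasure lborel A \<le> ennreal M" "0 \<le> M"
    and \<mu>: "0 \<le> \<mu>" "0 \<le> \<kappa>"
    and inf: "\<And>x. x \<in> A \<Longrightarrow> p x = \<infinity> \<Longrightarrow> 1 \<le> \<mu>"
    and fin: "\<And>x t. x \<in> A \<Longrightarrow> p x \<noteq> \<infinity> \<Longrightarrow> 0 \<le> t \<Longrightarrow> t \<le> \<mu> + \<kappa> * t powr real_of_ereal (p x)"
  shows "(\<integral>\<^sup>+x\<in>A. ennreal (norm (g x)) \<partial>lborel) \<le> ennreal (L * (\<mu> * M + \<kappa>))"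
proof -
  note [measurable] = h
  have [measurable]: "A \<in> sets lebesgue" using A(1) by simp
  have "(\<integral>\<^sup>+x\<in>A. ennreal (norm (g x)) \<partial>lborel) = (\<integral>\<^sup>+x\<in>A. ennreal (norm (g x)) \<partial>lebesgue)"
    by (rule nn_integral_completion[symmetric])
  also have "\<dots> = (\<integral>\<^sup>+x. ennreal l * ennreal (norm (h x) * indicator A x) \<partial>lebesgue)"
    using g
  proof (intro nn_integral_cong_AE, eventually_elim)
    case (elim x)
    then show ?case using l by (auto simp: ennreal_mult'[symmetric] split: split_indicator)
  qed
  also have "\<dots> = ennreal l * (\<integral>\<^sup>+x. ennreal (norm (h x) * indicator A x) \<partial>lebesgue)"
    by (intro nn_integral_cmult) measurable
  also have "\<dots> \<le> ennreal l * (ennreal \<mu> * (\<integral>\<^sup>+x. ennreal (indicator A x) \<partial>lebesgue) + ennreal \<kappa>)"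
    using A(1) inf fin
    by (intro mult_left_mono nn_integral_modular_le[OF p h mod _ _ _ \<mu>])
      (auto split: split_indicator_asm split_indicator)
  also have "(\<integral>\<^sup>+x. ennreal (indicator A x) \<partial>lebesgue) = emeasure lborel A"
    using A(1) by (simp add: ennreal_indicator)
  also have "ennreal l * (ennreal \<mu> * emeasure lborel A + ennreal \<kappa>) \<le> ennreal L * (ennreal \<mu> * ennreal M + ennreal \<kappa>)"
    using A(2) l by (intro mult_mono add_mono ennreal_leI) auto
  also have "\<dots> = ennreal (L * (\<mu> * M + \<kappa>))"
    using A(3) \<mu> l by (simp add: ennreal_mult')
  finally show ?thesis .
qed

text \<open>The signed sums have norm O(N^(1/r)) with r = 2 + \<epsilon>, and for any
  \<open>q\<close> the target norm controls the integral over [-b, b]. As 1 / r < 1 / 2, this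
  contradicts the lower bound of order sqrt N.\<close>

lemma fourier_bounded_domain_intervals:
  fixes I :: "nat \<Rightarrow> real set"
  assumes \<epsilon>: "0 < \<epsilon>" and p: "p \<in> exponents" and q: "q \<in> exponents" and bdd: "fourier_bounded p q"
    and I: "\<And>j. is_interval (I j)" "disjoint_family I"
    and fin: "emeasure lebesgue ((\<Union>j. I j) - {x. ereal (2 + \<epsilon>) < p x}) < \<infinity>"
  shows "(\<lambda>j. emeasure lebesgue (I j)) \<longlonglongrightarrow> 0"
proof (rule ccontr)
  assume large: "\<not> (\<lambda>j. emeasure lebesgue (I j)) \<longlonglongrightarrow> 0"
  define r where "r = 2 + \<epsilon>"
  have r: "2 < r" using \<epsilon> by (simp add: r_def)
  have [measurable]: "p \<in> borel_measurable lebesgue" using p by (simp add: exponents_def)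
  have "{x \<in> space lebesgue. ereal r < p x} \<in> sets lebesgue" by measurable
  then have E: "{x. ereal r < p x} \<in> sets lebesgue" by simp
  obtain \<delta> b c where \<delta>: "0 < \<delta>" and b: "0 < b" and c: "0 < c"
    and ex: "\<forall>N. \<exists>f A. A \<in> sets borel \<and> A \<subseteq> {x. ereal r < p x} \<and> emeasure lborel A \<le> ennreal (real N * \<delta>) \<and>
      integrable lborel f \<and> (\<forall>x. norm (f x :: complex) \<le> indicator A x) \<and>
      ennreal (c * sqrt (real N)) \<le> (\<integral>\<^sup>+x\<in>{-b..b}. ennreal (norm (fourier f x)) \<partial>lborel)"
    using large_fourier_on_interval[OF I E fin[folded r_def] large] .
  obtain C where C: "0 < C" and bd: "\<forall>f\<in>Lvar p. \<exists>h\<in>Lvar q.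
      represents h (fourier_dist (dist_of_fun f)) \<and> Lvar_norm q h \<le> C * Lvar_norm p f"
    using bdd unfolding fourier_bounded_def by blast
  \<comment> \<open>The first summand makes the integral part of the modular at most 1/2, the second
    makes \<open>L\<close> at least 2 and hence the supremum part at most 1/2.\<close>
  define M where "M = 2 * \<delta> + 2 powr r"
  have M: "2 * \<delta> \<le> M" "2 powr r \<le> M" "0 < M"
    using \<delta> by (auto simp: M_def intro: add_pos_nonneg)
  define K where "K = 2 * C * M powr (1 / r) * (2 * b + 1)"
  obtain N :: nat where N: "1 \<le> N" "K * real N powr (1 / r) < c * sqrt (real N)"
    using sqrt_not_le_powr[of "1 / r" c K] r c by (auto simp: field_simps)
  obtain f A where A: "A \<in> sets borel" "A \<subseteq> {x. ereal r < p x}" "emeasure lborel A \<le> ennreal (real N * \<delta>)"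
    and f: "integrable lborel f" "\<And>x. norm (f x) \<le> indicator A x"
    and ge: "ennreal (c * sqrt (real N)) \<le> (\<integral>\<^sup>+x\<in>{-b..b}. ennreal (norm (fourier f x)) \<partial>lborel)"
    using spec[OF ex, of N] by blast
  \<comment> \<open>Chosen so that \<open>L powr (- r)\<close> cancels the factor
    \<open>real N\<close> in the measure of the support.\<close>
  define L where "L = (M * real N) powr (1 / r)"
  have "2 powr r * 1 \<le> M * real N"
    using M N(1) by (intro mult_mono) auto
  then have "(2 powr r) powr (1 / r) \<le> L"
    unfolding L_def using r by (intro powr_mono2) auto
  then have L: "2 \<le> L" using r by (simp add: powr_powr)
  have "L powr (- r) = 1 / (M * real N)"
    unfolding L_def using r M N(1) by (simp add: powr_powr powr_minus_divide)
  then have "real N * \<delta> * L powr (- r) = \<delta> / M"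
    using N(1) by simp
  moreover have "\<delta> / M \<le> 1 / 2" "1 / L \<le> 1 / 2"
    using M L by (simp_all add: field_simps)
  ultimately have le: "real N * \<delta> * L powr (- r) + 1 / L \<le> 1"
    by linarith
  have fm: "f \<in> borel_measurable lebesgue"
    using borel_measurable_integrable[OF f(1)] by (rule measurable_completion)
  have pr: "ereal r \<le> p x" if "x \<in> A" for x
    using A(2) that by (auto intro: less_imp_le)
  have Lv: "f \<in> Lvar p" "Lvar_norm p f \<le> L"
    using bounded_support_Lvar[OF p fm f(2) _ _ _ pr _ le] A \<delta> L by auto
  obtain h l where h: "h \<in> borel_measurable lebesgue" "0 < l" "l \<le> 2 * C * L"
    "modular q h \<le> 1" "AE x in lebesgue. fourier f x = l *\<^sub>R h x"
    using fourier_bounded_on_integrable[OF q C bd f(1) Lv] L by auto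
  have "(\<integral>\<^sup>+x\<in>{-b..b}. ennreal (norm (fourier f x)) \<partial>lborel) \<le> ennreal (2 * C * L * (1 * (2 * b) + 1))"
  proof (rule nn_integral_set_modular_le[OF q h(1,4,5,2,3)])
    show "t \<le> 1 + 1 * t powr real_of_ereal (q x)" if "q x \<noteq> \<infinity>" "0 \<le> t" for x t
      using le_add_powr_exponent[of 1 "real_of_ereal (q x)" "real_of_ereal (q x)" t] real_of_exponent_ge_1[OF q that(1)] that(2) by simp
  qed (use b in auto)
  then have "(\<integral>\<^sup>+x\<in>{-b..b}. ennreal (norm (fourier f x)) \<partial>lborel) \<le> ennreal (2 * C * L * (2 * b + 1))"
    by simp
  with ge have "ennreal (c * sqrt (real N)) \<le> ennreal (2 * C * L * (2 * b + 1))"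
    by (rule order_trans)
  then have "c * sqrt (real N) \<le> 2 * C * L * (2 * b + 1)"
    using C L b by (subst (asm) ennreal_le_iff) auto
  also have "\<dots> = K * real N powr (1 / r)"
    unfolding K_def L_def using M by (simp add: powr_mult)
  finally show False using N(2) by simp
qed

text \<open>Dually, the multiplication formula moves the transform from the signed sum onto the bounded
  function \<open>f0\<close> below, so the norm in the target space is tested on the sets where \<open>q\<close> is small.\<close>

lemma fourier_bounded_range_intervals:
  fixes J :: "nat \<Rightarrow> real set"
  assumes \<epsilon>: "0 < \<epsilon>" and p: "p \<in> exponents" and q: "q \<in> exponents" and bdd: "fourier_bounded p q"
    and J: "\<And>j. is_interval (J j)" "disjoint_family J"
    and fin: "emeasure lebesgue ((\<Union>j. J j) - {x. q x < ereal (2 - \<epsilon>)}) < \<infinity>"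
  shows "(\<lambda>j. emeasure lebesgue (J j)) \<longlonglongrightarrow> 0"
proof (rule ccontr)
  assume large: "\<not> (\<lambda>j. emeasure lebesgue (J j)) \<longlonglongrightarrow> 0"
  \<comment> \<open>The minimum keeps \<open>r\<close> in [3/2, 2) even for large \<epsilon>, while
    r >= 2 - \<epsilon> still bounds \<open>q\<close> on the pieces.\<close>
  define r where "r = 2 - min \<epsilon> (1 / 2)"
  have r: "1 < r" "r < 2" "2 - \<epsilon> \<le> r" using \<epsilon> by (auto simp: r_def min_def)
  have [measurable]: "q \<in> borel_measurable lebesgue" using q by (simp add: exponents_def)
  have "{x \<in> space lebesgue. q x < ereal (2 - \<epsilon>)} \<in> sets lebesgue" by measurable
  then have E: "{x. q x < ereal (2 - \<epsilon>)} \<in> sets lebesgue" by simp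
  obtain \<delta> b c where \<delta>: "0 < \<delta>" and b: "0 < b" and c: "0 < c"
    and ex: "\<forall>N. \<exists>f A. A \<in> sets borel \<and> A \<subseteq> {x. q x < ereal (2 - \<epsilon>)} \<and> emeasure lborel A \<le> ennreal (real N * \<delta>) \<and>
      integrable lborel f \<and> (\<forall>x. norm (f x :: complex) \<le> indicator A x) \<and>
      ennreal (c * sqrt (real N)) \<le> (\<integral>\<^sup>+x\<in>{-b..b}. ennreal (norm (fourier f x)) \<partial>lborel)"
    using large_fourier_on_interval[OF J E fin large] .
  obtain C where C: "0 < C" and bd: "\<forall>f\<in>Lvar p. \<exists>h\<in>Lvar q.
      represents h (fourier_dist (dist_of_fun f)) \<and> Lvar_norm q h \<le> C * Lvar_norm p f"
    using bdd unfolding fourier_bounded_def by blast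
  \<comment> \<open>A scale for functions bounded by 1 on [-b, b]: with lower exponent 1 the two
    parts of the modular bound are 2 b / L and 1 / L, with sum exactly 1.\<close>
  define L where "L = 2 * b + 1"
  have L: "1 \<le> L" using b by (simp add: L_def)
  define \<theta> where "\<theta> = 1 - 1 / r"
  have "\<theta> < 1 / 2" using r by (simp add: \<theta>_def field_simps)
  then obtain N :: nat where N: "1 \<le> N" "2 * C * L * (\<delta> + 1) * real N powr \<theta> < c * sqrt (real N)"
    using sqrt_not_le_powr[of \<theta> c "2 * C * L * (\<delta> + 1)"] c by auto
  obtain f A where A: "A \<in> sets borel" "A \<subseteq> {x. q x < ereal (2 - \<epsilon>)}" "emeasure lborel A \<le> ennreal (real N * \<delta>)"
    and f: "integrable lborel f" "\<And>x. norm (f x) \<le> indicator A x"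
    and ge: "ennreal (c * sqrt (real N)) \<le> (\<integral>\<^sup>+x\<in>{-b..b}. ennreal (norm (fourier f x)) \<partial>lborel)"
    using spec[OF ex, of N] by blast
  note [measurable] = borel_measurable_fourier[OF f(1)]
  \<comment> \<open>The conjugate phase of the transform, so that pairing with it gives the integral
    of the modulus. At a zero of the transform division by zero gives 0, consistent with both the
    bound and the product formula.\<close>
  define f0 where "f0 = (\<lambda>x. indicator {-b..b} x * (cnj (fourier f x) / of_real (norm (fourier f x))))"
  have "(\<lambda>x. cnj (fourier f x)) \<in> borel_measurable borel"
    by (intro borel_measurable_continuous_onI continuous_on_cnj continuous_on_fourier f)
  then have f0m: "f0 \<in> borel_measurable borel"
    unfolding f0_def by measurable
  have f0_le: "norm (f0 x) \<le> indicator {-b..b} x" for x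
    by (auto simp: f0_def norm_mult norm_divide split: split_indicator)
  have f0_int: "integrable lborel f0"
    by (rule Bochner_Integration.integrable_bound[OF integrable_indicator_Icc(1)[of "{-b..b}" "-b" b]])
      (use f0m f0_le in auto)
  have f0_mult: "f0 x * fourier f x = of_real (norm (fourier f x) * indicator {-b..b} x)" for x
  proof -
    have "cnj (fourier f x) * fourier f x = of_real (norm (fourier f x)) * of_real (norm (fourier f x))"
      using complex_norm_square[of "fourier f x"] by (simp add: power2_eq_square mult.commute)
    then show ?thesis by (auto simp: f0_def split: split_indicator)
  qed
  have p1: "ereal 1 \<le> p x" for x using p by (simp add: exponents_def one_ereal_def)
  have "2 * b * L powr (- 1) + 1 / L \<le> 1"
    using b by (simp add: L_def powr_minus_divide field_simps)
  then have Lv: "f0 \<in> Lvar p" "Lvar_norm p f0 \<le> L"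
    using bounded_support_Lvar[OF p measurable_completion f0_le, of "2 * b" 1 L] f0m b L p1 by auto
  obtain h l where h: "h \<in> borel_measurable lebesgue" "0 < l" "l \<le> 2 * C * L"
    "modular q h \<le> 1" "AE x in lebesgue. fourier f0 x = l *\<^sub>R h x"
    using fourier_bounded_on_integrable[OF q C bd f0_int Lv] L by auto
  \<comment> \<open>Balances the two error terms: \<mu> N and \<mu>^(1 - r) both equal
    N^\<theta>.\<close>
  define \<mu> where "\<mu> = real N powr (- 1 / r)"
  have \<mu>: "0 < \<mu>" "\<mu> \<le> 1"
    unfolding \<mu>_def using N(1) r powr_mono[of "- 1 / r" 0 "real N"] by simp_all
  have "\<mu> * real N = real N powr \<theta>"
    unfolding \<mu>_def \<theta>_def using N(1) by (simp add: powr_diff powr_minus_divide)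
  then have \<mu>1: "\<mu> * (real N * \<delta>) = \<delta> * real N powr \<theta>" by (simp add: mult.assoc[symmetric])
  have "- 1 / r * (1 - r) = \<theta>"
    unfolding \<theta>_def using r by (simp add: field_simps)
  then have \<mu>2: "\<mu> powr (1 - r) = real N powr \<theta>"
    unfolding \<mu>_def powr_powr by simp
  have f0_F: "integrable lborel (\<lambda>x. f0 x * fourier f x)"
    by (intro integrable_mult_fourier f0_int f)
  have F_f: "integrable lborel (\<lambda>x. fourier f0 x * f x)"
    using integrable_mult_fourier[OF f(1) f0_int] by (simp add: mult.commute)
  have "(\<integral>\<^sup>+x\<in>{-b..b}. ennreal (norm (fourier f x)) \<partial>lborel) = (\<integral>\<^sup>+x. ennreal (norm (f0 x * fourier f x)) \<partial>lborel)"
    unfolding f0_mult by (intro nn_integral_cong) (auto split: split_indicator)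
  also have "\<dots> = ennreal (LINT x|lborel. norm (f0 x * fourier f x))"
    using f0_F by (intro nn_integral_eq_integral) auto
  also have "(LINT x|lborel. norm (f0 x * fourier f x)) = norm (LINT x|lborel. f0 x * fourier f x)"
    unfolding f0_mult integral_complex_of_real norm_of_real by (simp add: abs_mult)
  also have "(LINT x|lborel. f0 x * fourier f x) = (LINT x|lborel. fourier f0 x * f x)"
    by (rule fourier_multiplication[OF f0_int f(1)])
  also have "ennreal (norm \<dots>) \<le> (\<integral>\<^sup>+x. ennreal (norm (fourier f0 x * f x)) \<partial>lborel)"
    by (rule integral_norm_bound_ennreal[OF F_f])
  also have "\<dots> \<le> (\<integral>\<^sup>+x\<in>A. ennreal (norm (fourier f0 x)) \<partial>lborel)"
  proof (rule nn_integral_mono)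
    fix x
    have "norm (fourier f0 x * f x) \<le> norm (fourier f0 x) * indicator A x"
      unfolding norm_mult by (intro mult_left_mono f) simp
    then show "ennreal (norm (fourier f0 x * f x)) \<le> ennreal (norm (fourier f0 x)) * indicator A x"
      by (auto simp: ennreal_leI split: split_indicator_asm split_indicator)
  qed
  also have "\<dots> \<le> ennreal (2 * C * L * (\<mu> * (real N * \<delta>) + \<mu> powr (1 - r)))"
  proof (rule nn_integral_set_modular_le[OF q h(1,4,5,2,3) A(1,3)])
    fix x assume x: "x \<in> A"
    then have qx: "q x < ereal (2 - \<epsilon>)" using A(2) by blast
    then show "1 \<le> \<mu>" if "q x = \<infinity>" using that by simp
    show "t \<le> \<mu> + \<mu> powr (1 - r) * t powr real_of_ereal (q x)" if "q x \<noteq> \<infinity>" "0 \<le> t" for t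
    proof (rule le_add_powr_exponent[OF \<mu> real_of_exponent_ge_1[OF q that(1)] _ that(2)])
      show "real_of_ereal (q x) \<le> r"
        using qx that(1) r(3) real_of_exponent_ge_1[OF q that(1)] by (cases "q x") auto
    qed
  qed (use \<mu> \<delta> in auto)
  also have "2 * C * L * (\<mu> * (real N * \<delta>) + \<mu> powr (1 - r)) = 2 * C * L * (\<delta> + 1) * real N powr \<theta>"
    unfolding \<mu>1 \<mu>2 by (simp add: algebra_simps)
  finally have "ennreal (c * sqrt (real N)) \<le> ennreal (2 * C * L * (\<delta> + 1) * real N powr \<theta>)"
    using ge by (rule order_trans[rotated])
  then have "c * sqrt (real N) \<le> 2 * C * L * (\<delta> + 1) * real N powr \<theta>"
    using C L \<delta> by (subst (asm) ennreal_le_iff) auto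
  then show False using N(2) by simp
qed

theorem theorem4p1:
  fixes \<epsilon> :: real and p q :: "real \<Rightarrow> ereal"
  assumes "\<epsilon> > 0" and "p \<in> exponents" and "q \<in> exponents" and "fourier_bounded p q"
  shows "(\<forall>(G :: real set) I :: nat \<Rightarrow> real set.
            (\<forall>j. is_interval (I j)) \<longrightarrow> disjoint_family I \<longrightarrow> G = (\<Union>j. I j) \<longrightarrow>
            {x. p x > ereal (2 + \<epsilon>)} \<subseteq> G \<longrightarrow>
            emeasure lebesgue (G - {x. p x > ereal (2 + \<epsilon>)}) < \<infinity> \<longrightarrow>
            (\<lambda>j. emeasure lebesgue (I j)) \<longlonglongrightarrow> 0) \<and>
         (\<forall>(U :: real set) J :: nat \<Rightarrow> real set.
            (\<forall>j. is_interval (J j)) \<longrightarrow> disjoint_family J \<longrightarrow> U = (\<Union>j. J j) \<longrightarrow>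
            {x. q x < ereal (2 - \<epsilon>)} \<subseteq> U \<longrightarrow>
            emeasure lebesgue (U - {x. q x < ereal (2 - \<epsilon>)}) < \<infinity> \<longrightarrow>
            (\<lambda>j. emeasure lebesgue (J j)) \<longlonglongrightarrow> 0)"
  using fourier_bounded_domain_intervals[OF assms] fourier_bounded_range_intervals[OF assms]
  by blast

end
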